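(* Any Extended Polynomial Calculus with square root refutation over $\mathbb{Q}$ (denoted $\mathsf{Ext}$-$\mathsf{PC}^{\sqrt{\ }}_{\mathbb{Q}}$) of $\mathsf{BVP}_n$ requires size $\Omega(2^n)$.
   Context: $\mathsf{BVP}_n$ is the unsatisfiable system $x_1 + 2x_2 + \ldots + 2^{n-1}x_n + 1 = 0$, $x_i^2 - x_i = 0$ for $i=1,\ldots,n$. A $\mathsf{PC}^{\sqrt{\ }}_R$ refutation over a ring $R$ of a set $\Gamma$ is a sequence $R_1,\ldots,R_s$ ending in a nonzero constant of $R$, where each line is in $\Gamma$ or obtained by $R_l = \alpha R_j + \beta R_k$ ($\alpha,\beta\in R$), $R_l = x_i R_k$, or $R_l^2 = R_k$ (square root rule). Size is the sum of the line sizes; a rational polynomial with coefficients $p_i/q_i$ has size $\sum \lceil\log|p_i|\rceil + \lceil\log|q_i|\rceil$. An $\mathsf{Ext}$-$\mathsf{PC}^{\sqrt{\ }}_R$ refutation of $\Gamma$ is a $\mathsf{PC}^{\sqrt{\ }}_R$ refutation of $\Gamma \cup \{y_1 - Q_1(\vec x), \ldots, y_m - Q_m(\vec x, y_1,\ldots,y_{m-1})\}$ for arbitrary polynomials $Q_i$ over $R$, with size equal to that refutation's size. *)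

theory Defs
  imports Complex_Main "HOL-Library.Poly_Mapping"
begin

type_synonym ('v, 'r) mpoly = "('v \<Rightarrow>\<^sub>0 nat) \<Rightarrow>\<^sub>0 'r"

definition const_poly :: "'r::zero \<Rightarrow> ('v, 'r) mpoly" where
  "const_poly c = Poly_Mapping.single 0 c"

definition var_poly :: "'v \<Rightarrow> ('v, 'r::zero_neq_one) mpoly" where
  "var_poly v = Poly_Mapping.single (Poly_Mapping.single v 1) 1"

definition vars :: "('v, 'r::zero) mpoly \<Rightarrow> 'v set" where
  "vars P = (\<Union>m\<in>Poly_Mapping.keys P. Poly_Mapping.keys m)"

text \<open>Refutations in the ring of polynomials over \<open>'r\<close> in the variables \<open>V\<close>.\<close>

definition pc_sqrt_refutation ::
  "'v set \<Rightarrow> ('v, 'r::comm_ring_1) mpoly set \<Rightarrow> ('v, 'r) mpoly list \<Rightarrow> bool" where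
  "pc_sqrt_refutation V \<Gamma> Rs \<longleftrightarrow>
     Rs \<noteq> [] \<and>
     (\<forall>R\<in>set Rs. vars R \<subseteq> V) \<and>
     (\<exists>c. c \<noteq> 0 \<and> last Rs = const_poly c) \<and>
     (\<forall>l<length Rs.
        Rs ! l \<in> \<Gamma> \<or>
        (\<exists>j<l. \<exists>k<l. \<exists>\<alpha> \<beta>. Rs ! l = const_poly \<alpha> * Rs ! j + const_poly \<beta> * Rs ! k) \<or>
        (\<exists>k<l. \<exists>v\<in>V. Rs ! l = var_poly v * Rs ! k) \<or>
        (\<exists>k<l. (Rs ! l)\<^sup>2 = Rs ! k))"

text \<open>The variables \<open>x\<^sub>1, x\<^sub>2, \<dots>\<close> of the refuted system and the extension variables
  \<open>y\<^sub>1, y\<^sub>2, \<dots>\<close>; indices start at 1.\<close>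

datatype var = XVar nat | YVar nat

definition ext_pc_sqrt_refutation ::
  "nat \<Rightarrow> (var, 'r::comm_ring_1) mpoly set \<Rightarrow> (var, 'r) mpoly list \<Rightarrow> bool" where
  "ext_pc_sqrt_refutation n \<Gamma> Rs \<longleftrightarrow>
     (\<exists>m Q. (\<forall>i\<in>{1..m}. vars (Q i) \<subseteq> XVar ` {1..n} \<union> YVar ` {1..<i}) \<and>
        pc_sqrt_refutation (XVar ` {1..n} \<union> YVar ` {1..m})
          (\<Gamma> \<union> (\<lambda>i. var_poly (YVar i) - Q i) ` {1..m}) Rs)"

definition BVP :: "nat \<Rightarrow> (var, 'r::comm_ring_1) mpoly set" where
  "BVP n =
     insert ((\<Sum>i=1..n. const_poly (2 ^ (i - 1)) * var_poly (XVar i)) + 1)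
       ((\<lambda>i. (var_poly (XVar i))\<^sup>2 - var_poly (XVar i)) ` {1..n})"

text \<open>Bit sizes: the logarithm is binary, fractions are in lowest terms, and only the
  monomials with nonzero coefficient count. In particular, coefficients \<open>1\<close> and \<open>-1\<close>
  have size \<open>0\<close>.\<close>

definition rat_size :: "rat \<Rightarrow> int" where
  "rat_size r = (case quotient_of r of (p, q) \<Rightarrow>
     \<lceil>log 2 \<bar>real_of_int p\<bar>\<rceil> + \<lceil>log 2 \<bar>real_of_int q\<bar>\<rceil>)"

definition poly_size :: "('v, rat) mpoly \<Rightarrow> int" where
  "poly_size P = (\<Sum>m\<in>Poly_Mapping.keys P. rat_size (Poly_Mapping.lookup P m))"

definition refutation_size :: "('v, rat) mpoly list \<Rightarrow> int" where
  "refutation_size Rs = (\<Sum>R\<leftarrow>Rs. poly_size R)"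

end

theory Submission
  imports Defs "HOL-Computational_Algebra.Squarefree" "HOL-Real_Asymp.Real_Asymp"
    "Jordan_Normal_Form.Determinant"
begin

text \<open>Let \<open>p \<le> 2\<^sup>n\<close> be an odd prime and give the variables \<open>x\<^sub>i\<close> the binary digits of \<open>p - 1\<close>. All
  axioms then vanish modulo \<open>p\<close>, and multiplication by variables and the square root rule preserve this,
  whereas the final constant does not vanish modulo \<open>p\<close> unless \<open>p\<close> divides it. So \<open>p\<close> divides the
  numerator or denominator of a coefficient of some line, or else some step
  \<open>R\<^sub>l = \<alpha> R\<^sub>j + \<beta> R\<^sub>k\<close> uses scalars that are not integral at \<open>p\<close>. As the scalars do not
  count towards the size, the second case must be charged to the lines: there \<open>R\<^sub>j\<close> and \<open>R\<^sub>k\<close> have the same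
  monomials and are proportional modulo \<open>p\<close>. Normalize the lines with a given set \<open>M\<close> of monomials at
  a monomial where their coefficients are small on average. For \<open>p\<close> not dividing the numerator of any
  \<open>r\<^sup>2 - 1 \<noteq> 0\<close>, with \<open>r\<close> a normalized coefficient, the two lines agree where their coefficients are
  \<open>1\<close> or \<open>-1\<close>. Among the lines with the same such part, \<open>p\<close> divides one fixed nonzero minor,
  because all lines before step \<open>l\<close> vanish modulo \<open>p\<close> at the chosen point and \<open>R\<^sub>l\<close> does not. The
  logarithms of all these integers sum to at most \<open>1\<close> plus nine times the size, while their
  product is divisible by every prime up to \<open>2\<^sup>n\<close>; Chebyshev's bound concludes.\<close>

section \<open>A Chebyshev bound\<close>

text \<open>The number \<open>1 / (i * ((i + j) choose j))\<close> is the integral of x^(i-1)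
  (1-x)^j over [0,1], an entry of the Leibniz harmonic triangle. The identity integrates (1-x)^(j+1)
  = (1-x)^j - x (1-x)^j times x^(i-1).\<close>

lemma inverse_mult_binomial_diff:
  fixes i j :: nat
  assumes "i > 0"
  shows "1 / (real i * real ((i + Suc j) choose Suc j)) =
    1 / (real i * real ((i + j) choose j)) - 1 / (real (Suc i) * real ((Suc i + j) choose j))"
proof -
  define A where "A = real ((i + j) choose j)"
  define B where "B = real ((Suc i + j) choose j)"
  define C where "C = real ((i + Suc j) choose Suc j)"
  have A0: "A > 0" and B0: "B > 0" and C0: "C > 0"
    unfolding A_def B_def C_def by (simp_all del: binomial_Suc_Suc)
  have partial: "y / (x * (x + y) * a) = 1 / (x * a) - 1 / ((x + y) * a)"
    if "x > 0" "y > 0" "a > 0" for x y a :: real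
    using that by (simp add: divide_simps)
  have "Suc j * ((i + Suc j) choose Suc j) = Suc (i + j) * ((i + j) choose j)"
    using Suc_times_binomial_eq[of "i + j" j] by (simp add: mult.commute)
  hence C: "real (Suc j) * C = real (Suc (i + j)) * A"
    unfolding A_def C_def by (metis of_nat_mult)
  have "Suc i * ((Suc i + j) choose Suc i) = Suc (i + j) * ((i + j) choose i)"
    using Suc_times_binomial_eq[of "i + j" i] by (simp add: mult.commute)
  moreover have "(Suc i + j) choose Suc i = (Suc i + j) choose j"
    and "(i + j) choose i = (i + j) choose j"
    using binomial_symmetric[of "Suc i" "Suc i + j"] binomial_symmetric[of i "i + j"] by simp_all
  ultimately have B: "real (Suc i) * B = real (Suc (i + j)) * A"
    unfolding A_def B_def by (metis of_nat_mult)
  have "real (Suc j) / (real i * (real (Suc (i + j)) * A)) = 1 / (real i * C)"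
    unfolding C[symmetric] using C0 assms by simp
  hence "1 / (real i * C) = real (Suc j) / (real i * real (Suc (i + j)) * A)"
    by (simp add: mult.assoc)
  also have "\<dots> = 1 / (real i * A) - 1 / (real (Suc (i + j)) * A)"
    using partial[of "real i" "real (Suc j)" A] A0 assms by (simp add: add_ac)
  also have "\<dots> = 1 / (real i * A) - 1 / (real (Suc i) * B)"
    by (simp only: B)
  finally show ?thesis
    unfolding A_def B_def C_def .
qed

text \<open>By induction on \<open>j\<close> the quotient of \<open>L\<close> by this product is an
  integer: the harmonic triangle recursion writes it as a difference of two such quotients, whose
  ranges of divisors lie in the present one.\<close>

lemma mult_binomial_dvd_common_multiple:
  fixes L :: nat
  assumes "i > 0" "\<And>t. i \<le> t \<Longrightarrow> t \<le> i + j \<Longrightarrow> t dvd L"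
  shows "i * ((i + j) choose j) dvd L"
proof -
  have "real L / (real i * real ((i + j) choose j)) \<in> \<int>"
    using assms
  proof (induction j arbitrary: i)
    case 0
    then obtain q where "L = i * q" by (metis add_0_right dvdE le_refl)
    thus ?case using 0 by simp
  next
    case (Suc j)
    have 1: "real L / (real i * real ((i + j) choose j)) \<in> \<int>"
      by (rule Suc.IH) (use Suc.prems in auto)
    have 2: "real L / (real (Suc i) * real ((Suc i + j) choose j)) \<in> \<int>"
      by (rule Suc.IH) (use Suc.prems in auto)
    have "real L / (real i * real ((i + Suc j) choose Suc j)) =
      real L * (1 / (real i * real ((i + Suc j) choose Suc j)))" by simp
    also have "\<dots> = real L / (real i * real ((i + j) choose j)) -
        real L / (real (Suc i) * real ((Suc i + j) choose j))"
      unfolding inverse_mult_binomial_diff[OF \<open>i > 0\<close>] by (simp add: right_diff_distrib)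
    finally show ?case using 1 2 by simp
  qed
  then obtain z :: int where "real L / (real i * real ((i + j) choose j)) = of_int z"
    by (rule Ints_cases)
  hence "real L = of_int z * real (i * ((i + j) choose j))"
    using assms(1) by (simp add: field_simps)
  hence "int L = z * int (i * ((i + j) choose j))"
    by (metis of_int_eq_iff of_int_mult of_int_of_nat_eq)
  thus ?thesis by (metis dvd_triv_right int_dvd_int_iff)
qed

section \<open>Numbers divisible by all primes up to a bound\<close>

lemma squarefree_dvdI:
  fixes s D :: nat
  assumes "squarefree s" "D \<noteq> 0" "\<And>p. prime p \<Longrightarrow> p dvd s \<Longrightarrow> p dvd D"
  shows "s dvd D"
proof (rule multiplicity_le_imp_dvd)
  show "s \<noteq> 0" using assms(1) by (metis not_squarefree_0)
  fix p :: nat assume p: "prime p"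
  show "multiplicity p s \<le> multiplicity p D"
  proof (cases "p dvd s")
    case True
    have "multiplicity p s \<le> 1"
      using assms(1) p \<open>s \<noteq> 0\<close> squarefree_factorial_semiring''[of s] by simp
    moreover have "multiplicity p D \<ge> 1"
      using assms(3)[OF p True] assms(2) p by (intro multiplicity_geI) auto
    ultimately show ?thesis by simp
  qed (simp add: not_dvd_imp_multiplicity_0)
qed

text \<open>Write \<open>t = s r\<^sup>2\<close> with \<open>s\<close> squarefree: then \<open>s\<close> divides \<open>D\<close> and \<open>r \<le> k\<close> divides \<open>fact k\<close>.\<close>
lemma central_binomial_le_of_primes_dvd:
  fixes D k m :: nat
  assumes "D \<noteq> 0" "m > 0" "2 * m \<le> k\<^sup>2"
    and primes: "\<And>p. prime p \<Longrightarrow> p \<le> 2 * m \<Longrightarrow> p dvd D"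
  shows "(2 * m) choose m \<le> D * (fact k)\<^sup>2"
proof -
  define L where "L = D * (fact k)\<^sup>2"
  have "t dvd L" if "m \<le> t" "t \<le> m + m" for t
  proof -
    define s where "s = squarefree_part t"
    define r where "r = square_part t"
    have t: "t = s * r\<^sup>2" unfolding s_def r_def by (simp add: squarefree_decompose)
    have "t > 0" using that assms by simp
    hence "r > 0" "s > 0" unfolding t by (auto intro!: Nat.gr0I)
    have "s dvd D"
    proof (rule squarefree_dvdI)
      show "squarefree s" unfolding s_def using \<open>t > 0\<close> by simp
      fix p :: nat assume p: "prime p" "p dvd s"
      hence "p dvd t" using t by simp
      hence "p \<le> t" using \<open>t > 0\<close> by (rule dvd_imp_le)
      thus "p dvd D" using that p by (intro primes) auto
    qed (use assms in simp)
    moreover have "r dvd fact k"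
    proof (rule dvd_fact)
      have "r\<^sup>2 \<le> t" using t \<open>s > 0\<close> by simp
      hence "r\<^sup>2 \<le> k\<^sup>2" using that assms(3) by linarith
      thus "r \<le> k" by (metis power2_nat_le_eq_le)
    qed (use \<open>r > 0\<close> in simp)
    ultimately show ?thesis
      unfolding t L_def by (intro mult_dvd_mono dvd_power_same)
  qed
  hence "m * ((m + m) choose m) dvd L"
    using assms by (intro mult_binomial_dvd_common_multiple) auto
  hence "((2 * m) choose m) dvd L"
    by (metis dvd_mult_right mult_2)
  thus ?thesis
    using assms by (intro dvd_imp_le) (auto simp: L_def)
qed

text \<open>With \<open>2 * m = 2 ^ n\<close>, the central binomial coefficient contributes
  \<open>2 ^ n - n\<close> bits. Since \<open>k\<close> is about the square root of
  \<open>2 ^ n\<close>, the factor \<open>(fact k)\<^sup>2\<close> costs only about n 2^(n/2)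
  bits.\<close>

lemma log_le_of_primes_dvd:
  fixes D n :: nat
  assumes "D \<noteq> 0" "n > 0" and primes: "\<And>p. prime p \<Longrightarrow> p \<le> 2 ^ n \<Longrightarrow> p dvd D"
  shows "2 ^ n - real n - real (n + 1) * 2 powr (real (n + 1) / 2) \<le> log 2 (real D)"
proof -
  define h where "h = (n + 1) div 2"
  define m :: nat where "m = 2 ^ (n - 1)"
  define k :: nat where "k = 2 ^ h"
  have m2: "2 * m = 2 ^ n" unfolding m_def using assms(2) by (cases n) auto
  have "2 * m \<le> k\<^sup>2" unfolding m2 k_def h_def power_mult[symmetric]
    by (intro power_increasing) auto
  hence "(2 * m) choose m \<le> D * (fact k)\<^sup>2"
    using assms by (intro central_binomial_le_of_primes_dvd) (auto simp: m2, auto simp: m_def)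
  moreover have "(fact k :: nat) \<le> k ^ k" using fact_le_power[of k, where 'a = nat] by simp
  ultimately have "(2 * m) choose m \<le> D * (k ^ k)\<^sup>2"
    by (meson le_trans mult_le_mono2 power_mono zero_le)
  hence "real ((2 * m) choose m) \<le> real D * (real k ^ k)\<^sup>2"
    by (metis of_nat_le_iff of_nat_mult of_nat_power)
  moreover have "4 ^ m / (2 * real m) \<le> real ((2 * m) choose m)"
    using central_binomial_lower_bound[of m] by (simp add: m_def)
  ultimately have "4 ^ m / (2 * real m) \<le> real D * (real k ^ k)\<^sup>2" by linarith
  moreover have "4 ^ m / (2 * real m) = 2 powr (2 ^ n - n)"
  proof -
    have "(4::real) ^ m = 2 ^ (2 * m)" by (simp add: power_mult)
    moreover have "2 * real m = 2 ^ n" using m2 by (metis of_nat_mult of_nat_numeral of_nat_power)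
    ultimately show ?thesis by (simp add: powr_diff m2 powr_realpow flip: powr_realpow)
  qed
  ultimately have *: "2 powr (2 ^ n - n) \<le> real D * (real k ^ k)\<^sup>2" by simp
  have D0: "real D > 0" using assms by simp
  have k0: "real k > 0" by (simp add: k_def)
  have "2 ^ n - real n \<le> log 2 (real D * (real k ^ k)\<^sup>2)"
    using * D0 k0 by (simp add: le_log_iff)
  also have "\<dots> = log 2 (real D) + 2 * (real k * real h)"
    using D0 k0 by (simp add: log_mult log_nat_power k_def)
  also have "2 * (real k * real h) \<le> real (n + 1) * 2 powr (real (n + 1) / 2)"
  proof -
    have h: "real h \<le> real (n + 1) / 2" unfolding h_def by (simp add: field_simps)
    have "real k = 2 powr real h" unfolding k_def by (simp add: powr_realpow)
    also have "\<dots> \<le> 2 powr (real (n + 1) / 2)" using h by simp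
    finally have "real k * (2 * real h) \<le> 2 powr (real (n + 1) / 2) * real (n + 1)"
      using h by (intro mult_mono) auto
    thus ?thesis by (simp add: algebra_simps)
  qed
  finally show ?thesis by simp
qed

section \<open>Evaluation of polynomials\<close>

definition monom_eval :: "('v \<Rightarrow> 'r) \<Rightarrow> ('v \<Rightarrow>\<^sub>0 nat) \<Rightarrow> 'r::comm_ring_1" where
  "monom_eval \<rho> m = (\<Prod>v\<in>Poly_Mapping.keys m. \<rho> v ^ Poly_Mapping.lookup m v)"

definition mpoly_eval :: "('v \<Rightarrow> 'r) \<Rightarrow> ('v, 'r) mpoly \<Rightarrow> 'r::comm_ring_1" where
  "mpoly_eval \<rho> P = (\<Sum>m\<in>Poly_Mapping.keys P. Poly_Mapping.lookup P m * monom_eval \<rho> m)"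

lemma monom_eval_superset:
  assumes "finite A" "Poly_Mapping.keys m \<subseteq> A"
  shows "monom_eval \<rho> m = (\<Prod>v\<in>A. \<rho> v ^ Poly_Mapping.lookup m v)"
  unfolding monom_eval_def using assms
  by (intro prod.mono_neutral_left) (auto simp: in_keys_iff)

lemma monom_eval_zero [simp]: "monom_eval \<rho> 0 = 1"
  by (simp add: monom_eval_def)

lemma monom_eval_add: "monom_eval \<rho> (m + m') = monom_eval \<rho> m * monom_eval \<rho> m'"
proof -
  let ?A = "Poly_Mapping.keys m \<union> Poly_Mapping.keys m'"
  have "Poly_Mapping.keys (m + m') \<subseteq> ?A" by (rule keys_add)
  thus ?thesis
    by (simp add: monom_eval_superset[of ?A] lookup_add power_add prod.distrib)
qed

lemma mpoly_eval_superset: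
  assumes "finite A" "Poly_Mapping.keys P \<subseteq> A"
  shows "mpoly_eval \<rho> P = (\<Sum>m\<in>A. Poly_Mapping.lookup P m * monom_eval \<rho> m)"
  unfolding mpoly_eval_def using assms
  by (intro sum.mono_neutral_left) (auto simp: in_keys_iff)

lemma mpoly_eval_zero [simp]: "mpoly_eval \<rho> 0 = 0"
  by (simp add: mpoly_eval_def)

lemma mpoly_eval_add: "mpoly_eval \<rho> (P + Q) = mpoly_eval \<rho> P + mpoly_eval \<rho> Q"
proof -
  let ?A = "Poly_Mapping.keys P \<union> Poly_Mapping.keys Q"
  have "Poly_Mapping.keys (P + Q) \<subseteq> ?A" by (rule keys_add)
  thus ?thesis
    by (simp add: mpoly_eval_superset[of ?A] lookup_add distrib_right sum.distrib)
qed

lemma mpoly_eval_diff: "mpoly_eval \<rho> (P - Q) = mpoly_eval \<rho> P - mpoly_eval \<rho> Q"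
  using mpoly_eval_add[of \<rho> "P - Q" Q] by simp

lemma mpoly_eval_sum: "mpoly_eval \<rho> (\<Sum>i\<in>I. P i) = (\<Sum>i\<in>I. mpoly_eval \<rho> (P i))"
  by (induction I rule: infinite_finite_induct) (simp_all add: mpoly_eval_add)

lemma mpoly_eval_single [simp]: "mpoly_eval \<rho> (Poly_Mapping.single m c) = c * monom_eval \<rho> m"
  by (simp add: mpoly_eval_def)

lemma mpoly_as_sum_single:
  "P = (\<Sum>m\<in>Poly_Mapping.keys P. Poly_Mapping.single m (Poly_Mapping.lookup P m))"
  by (rule poly_mapping_eqI) (simp add: lookup_sum lookup_single when_def in_keys_iff)

lemma mpoly_eval_mult: "mpoly_eval \<rho> (P * Q) = mpoly_eval \<rho> P * mpoly_eval \<rho> Q"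
proof -
  have "P * Q = (\<Sum>m\<in>Poly_Mapping.keys P. \<Sum>m'\<in>Poly_Mapping.keys Q.
      Poly_Mapping.single m (Poly_Mapping.lookup P m) * Poly_Mapping.single m' (Poly_Mapping.lookup Q m'))"
    by (subst mpoly_as_sum_single[of P], subst mpoly_as_sum_single[of Q]) (rule sum_product)
  hence "mpoly_eval \<rho> (P * Q) = (\<Sum>m\<in>Poly_Mapping.keys P. \<Sum>m'\<in>Poly_Mapping.keys Q.
      (Poly_Mapping.lookup P m * monom_eval \<rho> m) * (Poly_Mapping.lookup Q m' * monom_eval \<rho> m'))"
    by (simp only: mpoly_eval_sum mult_single mpoly_eval_single monom_eval_add ac_simps)
  thus ?thesis by (simp only: mpoly_eval_def sum_product)
qed

lemma mpoly_eval_const [simp]: "mpoly_eval \<rho> (const_poly c) = c"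
  by (simp add: const_poly_def)

lemma mpoly_eval_one [simp]: "mpoly_eval \<rho> 1 = 1"
  using mpoly_eval_single[of \<rho> 0 1] by simp

lemma mpoly_eval_var [simp]: "mpoly_eval \<rho> (var_poly v) = \<rho> v"
  by (simp add: var_poly_def monom_eval_def)

lemma mpoly_eval_power: "mpoly_eval \<rho> (P ^ k) = mpoly_eval \<rho> P ^ k"
  by (induction k) (simp_all add: mpoly_eval_mult)

lemma lookup_const_poly_mult:
  fixes P :: "('v, 'r::comm_ring_1) mpoly"
  shows "Poly_Mapping.lookup (const_poly c * P) m = c * Poly_Mapping.lookup P m"
proof -
  have "const_poly c * P = (\<Sum>m'\<in>Poly_Mapping.keys P. Poly_Mapping.single m' (c * Poly_Mapping.lookup P m'))"
    by (subst mpoly_as_sum_single[of P]) (simp add: sum_distrib_left const_poly_def mult_single)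
  thus ?thesis
    by (simp add: lookup_sum lookup_single when_def in_keys_iff)
qed

lemma mpoly_eval_cong:
  assumes "\<And>v. v \<in> vars P \<Longrightarrow> \<rho> v = \<rho>' v"
  shows "mpoly_eval \<rho> P = mpoly_eval \<rho>' P"
proof -
  have "monom_eval \<rho> m = monom_eval \<rho>' m" if "m \<in> Poly_Mapping.keys P" for m
    unfolding monom_eval_def using assms that by (intro prod.cong refl arg_cong2[where f = power]) (auto simp: vars_def)
  thus ?thesis by (simp add: mpoly_eval_def)
qed

section \<open>Localization at a prime\<close>

text \<open>\<open>p_integral p\<close> is the localization of the integers at \<open>p\<close> and \<open>p_ideal p\<close> its maximal ideal.\<close>

definition p_integral :: "int \<Rightarrow> rat set" where
  "p_integral p = {of_int a / of_int b | a b. \<not> p dvd b}"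

definition p_ideal :: "int \<Rightarrow> rat set" where
  "p_ideal p = {of_int (p * a) / of_int b | a b. \<not> p dvd b}"

lemma p_integralI: "\<not> p dvd b \<Longrightarrow> of_int a / of_int b \<in> p_integral p"
  by (auto simp: p_integral_def)

lemma prime_not_dvd_one: "prime p \<Longrightarrow> \<not> p dvd (1::int)"
  by (metis not_prime_unit)

lemma p_integral_of_int: "prime p \<Longrightarrow> of_int a \<in> p_integral p"
  using p_integralI[of p 1 a] by (simp only: prime_not_dvd_one of_int_1 div_by_1 not_False_eq_True)

lemma p_integral_of_nat: "prime p \<Longrightarrow> of_nat k \<in> p_integral p"
  using p_integral_of_int[of p "int k"] by simp

lemma p_integral_0: "prime p \<Longrightarrow> 0 \<in> p_integral p"
  and p_integral_1: "prime p \<Longrightarrow> 1 \<in> p_integral p"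
  using p_integral_of_int[of p 0] p_integral_of_int[of p 1] by simp_all

lemma p_integral_mult:
  assumes "prime p" "x \<in> p_integral p" "y \<in> p_integral p"
  shows "x * y \<in> p_integral p"
proof -
  obtain a b c d where "x = of_int a / of_int b" "\<not> p dvd b" "y = of_int c / of_int d" "\<not> p dvd d"
    using assms(2,3) by (auto simp: p_integral_def)
  thus ?thesis
    using p_integralI[of p "b * d" "a * c"] assms(1) by (simp add: prime_dvd_mult_iff)
qed

lemma p_integral_add:
  assumes "prime p" "x \<in> p_integral p" "y \<in> p_integral p"
  shows "x + y \<in> p_integral p"
proof -
  obtain a b c d where "x = of_int a / of_int b" "\<not> p dvd b" "y = of_int c / of_int d" "\<not> p dvd d"
    using assms(2,3) by (auto simp: p_integral_def)
  moreover from this have "b \<noteq> 0" "d \<noteq> 0" by auto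
  ultimately show ?thesis
    using p_integralI[of p "b * d" "a * d + c * b"] assms(1)
    by (simp add: prime_dvd_mult_iff add_frac_eq)
qed

lemma p_integral_minus: "prime p \<Longrightarrow> x \<in> p_integral p \<Longrightarrow> - x \<in> p_integral p"
  using p_integral_mult[of p "-1" x] p_integral_of_int[of p "-1"] by simp

lemma p_integral_diff:
  "prime p \<Longrightarrow> x \<in> p_integral p \<Longrightarrow> y \<in> p_integral p \<Longrightarrow> x - y \<in> p_integral p"
  using p_integral_add[of p x "-y"] p_integral_minus[of p y] by simp

lemma p_integral_power: "prime p \<Longrightarrow> x \<in> p_integral p \<Longrightarrow> x ^ k \<in> p_integral p"
  by (induction k) (auto intro: p_integral_1 p_integral_mult)

lemma p_integral_sum:
  "prime p \<Longrightarrow> (\<And>i. i \<in> I \<Longrightarrow> f i \<in> p_integral p) \<Longrightarrow> sum f I \<in> p_integral p"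
  by (induction I rule: infinite_finite_induct) (auto intro: p_integral_0 p_integral_add)

lemma p_integral_prod:
  "prime p \<Longrightarrow> (\<And>i. i \<in> I \<Longrightarrow> f i \<in> p_integral p) \<Longrightarrow> prod f I \<in> p_integral p"
  by (induction I rule: infinite_finite_induct) (auto intro: p_integral_1 p_integral_mult)

lemma p_ideal_0: "prime p \<Longrightarrow> 0 \<in> p_ideal p"
  unfolding p_ideal_def using prime_not_dvd_one by (intro CollectI exI[of _ 0] exI[of _ 1]) simp

lemma p_ideal_iff:
  assumes "prime p"
  shows "x \<in> p_ideal p \<longleftrightarrow> (\<exists>y\<in>p_integral p. x = of_int p * y)"
  unfolding p_ideal_def p_integral_def by fastforce

lemma p_ideal_mult:
  assumes "prime p" "x \<in> p_ideal p" "y \<in> p_integral p"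
  shows "x * y \<in> p_ideal p"
proof -
  obtain z where "z \<in> p_integral p" "x = of_int p * z"
    using assms by (auto simp: p_ideal_iff)
  thus ?thesis
    unfolding p_ideal_iff[OF assms(1)] using assms
    by (intro bexI[of _ "z * y"]) (auto intro: p_integral_mult)
qed

lemma p_ideal_add:
  assumes "prime p" "x \<in> p_ideal p" "y \<in> p_ideal p"
  shows "x + y \<in> p_ideal p"
proof -
  obtain z w where "z \<in> p_integral p" "x = of_int p * z" "w \<in> p_integral p" "y = of_int p * w"
    using assms by (auto simp: p_ideal_iff)
  thus ?thesis
    unfolding p_ideal_iff[OF assms(1)] using assms
    by (intro bexI[of _ "z + w"]) (auto intro: p_integral_add simp: distrib_left)
qed

lemma p_ideal_minus: "prime p \<Longrightarrow> x \<in> p_ideal p \<Longrightarrow> - x \<in> p_ideal p"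
  using p_ideal_mult[of p x "-1"] p_integral_of_int[of p "-1"] by simp

lemma p_ideal_sum:
  "prime p \<Longrightarrow> (\<And>i. i \<in> I \<Longrightarrow> f i \<in> p_ideal p) \<Longrightarrow> sum f I \<in> p_ideal p"
  by (induction I rule: infinite_finite_induct) (auto intro: p_ideal_0 p_ideal_add)

section \<open>Membership in the ideal, units and primality\<close>

lemma of_int_divide_in_p_ideal_iff:
  assumes "prime p" "\<not> p dvd b"
  shows "of_int a / of_int b \<in> p_ideal p \<longleftrightarrow> p dvd a"
proof
  assume "of_int a / of_int b \<in> p_ideal p"
  then obtain c d where cd: "(of_int a / of_int b :: rat) = of_int (p * c) / of_int d" "\<not> p dvd d"
    by (auto simp: p_ideal_def)
  have "b \<noteq> 0" "d \<noteq> 0" using assms cd by auto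
  hence "(of_int (a * d) :: rat) = of_int (p * c * b)"
    using cd by (simp add: field_simps)
  hence "a * d = p * (c * b)" by (simp only: of_int_eq_iff mult.assoc)
  hence "p dvd a * d" by simp
  thus "p dvd a" using cd assms by (simp add: prime_dvd_mult_iff)
next
  assume "p dvd a"
  then obtain c where "a = p * c" ..
  thus "of_int a / of_int b \<in> p_ideal p" using assms by (auto simp: p_ideal_def)
qed

lemma of_int_in_p_ideal_iff: "prime p \<Longrightarrow> of_int a \<in> p_ideal p \<longleftrightarrow> p dvd a"
  using of_int_divide_in_p_ideal_iff[of p 1 a] by (simp only: prime_not_dvd_one of_int_1 div_by_1 not_False_eq_True)

lemma p_integral_inverse:
  assumes "prime p" "x \<in> p_integral p" "x \<notin> p_ideal p"
  shows "inverse x \<in> p_integral p"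
proof -
  obtain a b where ab: "x = of_int a / of_int b" "\<not> p dvd b"
    using assms(2) by (auto simp: p_integral_def)
  hence "\<not> p dvd a" using assms of_int_divide_in_p_ideal_iff by blast
  thus ?thesis using ab p_integralI[of p a b] by simp
qed

text \<open>An integral element outside the ideal is a unit, so it can be cancelled. With
  \<open>x = y\<close> this makes the square root rule sound modulo \<open>p\<close>.\<close>

lemma p_ideal_prime_ideal:
  assumes "prime p" "x \<in> p_integral p" "y \<in> p_integral p" "x * y \<in> p_ideal p"
  shows "x \<in> p_ideal p \<or> y \<in> p_ideal p"
proof (rule ccontr)
  assume *: "\<not> ?thesis"
  hence "x * y * inverse y \<in> p_ideal p"
    using assms by (intro p_ideal_mult[of p "x * y"] p_integral_inverse) auto
  moreover have "y \<noteq> 0" using * p_ideal_0[OF assms(1)] by auto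
  ultimately show False using * by (simp only: mult.assoc right_inverse mult_1_right) simp
qed

text \<open>The hypotheses say that \<open>p\<close> occurs neither in the numerator nor in the denominator
  of \<open>x\<close>, so that \<open>x\<close> is a unit of the localization.\<close>

lemma
  assumes "prime p" "\<not> p dvd fst (quotient_of x) * snd (quotient_of x)"
  shows unit_p_integral: "x \<in> p_integral p" and unit_not_p_ideal: "x \<notin> p_ideal p"
proof -
  obtain a b where ab: "quotient_of x = (a, b)" by (cases "quotient_of x")
  hence "x = of_int a / of_int b" by (rule quotient_of_div)
  moreover have "\<not> p dvd a" "\<not> p dvd b" using assms ab by (auto simp: prime_dvd_mult_iff)
  ultimately show "x \<in> p_integral p" "x \<notin> p_ideal p"
    using of_int_divide_in_p_ideal_iff[OF assms(1)] p_integralI by auto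
qed

section \<open>Minors\<close>

text \<open>Columns are labelled by an arbitrary type, later the monomials, so \<open>g\<close>
  lists the chosen ones; row choices are composed into \<open>v\<close>.\<close>

definition minor :: "nat \<Rightarrow> (nat \<Rightarrow> 'c \<Rightarrow> 'a) \<Rightarrow> (nat \<Rightarrow> 'c) \<Rightarrow> 'a::comm_ring_1" where
  "minor r v g = det (mat r r (\<lambda>(s, t). v s (g t)))"

lemma minor_leibniz:
  "minor r v g = (\<Sum>\<pi> | \<pi> permutes {0..<r}. signof \<pi> * (\<Prod>s=0..<r. v s (g (\<pi> s))))"
proof -
  have "minor r v g = (\<Sum>\<pi> | \<pi> permutes {0..<r}.
      signof \<pi> * (\<Prod>s=0..<r. mat r r (\<lambda>(s, t). v s (g t)) $$ (s, \<pi> s)))"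
    unfolding minor_def by (rule det_def'[where n = r]) simp
  also have "\<dots> = (\<Sum>\<pi> | \<pi> permutes {0..<r}. signof \<pi> * (\<Prod>s=0..<r. v s (g (\<pi> s))))"
    by (intro sum.cong refl arg_cong2[where f = "(*)"] prod.cong)
       (auto dest: permutes_in_image)
  finally show ?thesis .
qed

lemma minor_p_integral:
  assumes "prime p" "\<And>s t. s < r \<Longrightarrow> t < r \<Longrightarrow> v s (g t) \<in> p_integral p"
  shows "minor r v g \<in> p_integral p"
  unfolding minor_leibniz
  using assms
  by (intro p_integral_sum p_integral_mult p_integral_prod)
     (auto simp: sign_def intro: p_integral_1 p_integral_minus dest: permutes_in_image)

lemma minor_of_int:
  "minor r (\<lambda>s c. of_int (v s c)) g = (of_int (minor r v g) :: 'a::comm_ring_1)"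
  unfolding minor_leibniz of_int_sum by (intro sum.cong) (auto simp: sign_def of_int_prod)

text \<open>Expanding the product of the row sums gives one nonnegative term for every function on
  the indices; the Leibniz formula has only the terms of the permutations.\<close>

lemma abs_minor_le:
  fixes v :: "nat \<Rightarrow> 'c \<Rightarrow> 'a::linordered_idom"
  shows "\<bar>minor r v g\<bar> \<le> (\<Prod>s<r. \<Sum>t<r. \<bar>v s (g t)\<bar>)"
proof -
  have "\<bar>minor r v g\<bar> \<le> (\<Sum>\<pi> | \<pi> permutes {0..<r}. \<bar>signof \<pi> * (\<Prod>s=0..<r. v s (g (\<pi> s)))\<bar>)"
    unfolding minor_leibniz by (rule sum_abs)
  \<comment> \<open>Restricted to the index range, permutations become members of the extensional
    function space over which the product of sums expands.\<close>
  also have "\<dots> = (\<Sum>\<pi> | \<pi> permutes {0..<r}. \<Prod>s\<in>{0..<r}. \<bar>v s (g (restrict \<pi> {0..<r} s))\<bar>)"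
    by (intro sum.cong) (auto simp: abs_mult sign_def abs_prod)
  also have "\<dots> = (\<Sum>\<sigma>\<in>(\<lambda>\<pi>. restrict \<pi> {0..<r}) ` {\<pi>. \<pi> permutes {0..<r}}.
      \<Prod>s\<in>{0..<r}. \<bar>v s (g (\<sigma> s))\<bar>)"
  proof (subst sum.reindex)
    show "inj_on (\<lambda>\<pi>. restrict \<pi> {0..<r}) {\<pi>. \<pi> permutes {0..<r}}"
    proof (rule inj_onI, rule ext)
      fix \<pi> \<tau> x
      assume *: "\<pi> \<in> {\<pi>. \<pi> permutes {0..<r}}" "\<tau> \<in> {\<pi>. \<pi> permutes {0..<r}}"
        and eq: "restrict \<pi> {0..<r} = restrict \<tau> {0..<r}"
      show "\<pi> x = \<tau> x"
        using fun_cong[OF eq, of x] * by (cases "x \<in> {0..<r}") (auto simp: permutes_not_in)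
    qed
  qed simp
  also have "\<dots> \<le> (\<Sum>\<sigma>\<in>Pi\<^sub>E {0..<r} (\<lambda>_. {0..<r}). \<Prod>s\<in>{0..<r}. \<bar>v s (g (\<sigma> s))\<bar>)"
    by (intro sum_mono2 finite_PiE) (auto simp: permutes_in_image prod_nonneg)
  also have "\<dots> = (\<Prod>s\<in>{0..<r}. \<Sum>t\<in>{0..<r}. \<bar>v s (g t)\<bar>)"
    by (rule prod_sum_PiE[symmetric]) auto
  finally show ?thesis by (simp add: atLeast0LessThan)
qed

section \<open>Laplace expansion, linearity and exchange of rows\<close>

lemma minor_eq_0_rows:
  assumes "i < r" "j < r" "i \<noteq> j" "v i = v j"
  shows "minor r v g = 0"
  unfolding minor_def by (rule det_identical_rows[where n = r and i = i and j = j]) (use assms in auto)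

lemma minor_eq_0_cols:
  assumes "i < r" "j < r" "i \<noteq> j" "g i = g j"
  shows "minor r v g = 0"
  unfolding minor_def by (rule det_identical_columns[where n = r and i = i and j = j]) (use assms in auto)

text \<open>Entries from \<open>s\<close> on move down by one place. The same operation deletes a
  column when applied to the column choice \<open>g\<close>.\<close>

definition drop_row :: "nat \<Rightarrow> (nat \<Rightarrow> 'x) \<Rightarrow> nat \<Rightarrow> 'x" where
  "drop_row s v i = (if i < s then v i else v (Suc i))"

lemma minor_expand_row:
  "minor (Suc r) v g = (\<Sum>t\<le>r. v r (g t) * ((-1) ^ (r + t) * minor r v (drop_row t g)))"
proof -
  let ?A = "mat (Suc r) (Suc r) (\<lambda>(s, t). v s (g t))"
  have "mat_delete ?A r t = mat r r (\<lambda>(s, t'). v s (drop_row t g t'))" if "t \<le> r" for t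
    using that by (intro eq_matI) (auto simp: mat_delete_def drop_row_def)
  thus ?thesis
    unfolding minor_def using laplace_expansion_row[of ?A "Suc r" r]
    by (simp add: cofactor_def lessThan_Suc_atMost)
qed

lemma minor_expand_col:
  "minor (Suc r) v g = (\<Sum>s\<le>r. v s (g r) * ((-1) ^ (r + s) * minor r (drop_row s v) g))"
proof -
  let ?A = "mat (Suc r) (Suc r) (\<lambda>(s, t). v s (g t))"
  have "mat_delete ?A s r = mat r r (\<lambda>(s', t). drop_row s v s' (g t))" if "s \<le> r" for s
    using that by (intro eq_matI) (auto simp: mat_delete_def drop_row_def)
  thus ?thesis
    unfolding minor_def using laplace_expansion_column[of ?A "Suc r" r]
    by (simp add: cofactor_def lessThan_Suc_atMost add.commute)
qed

lemma minor_cong: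
  assumes "\<And>s t. s < r \<Longrightarrow> t < r \<Longrightarrow> v s (g t) = v' s (g' t)"
  shows "minor r v g = minor r v' g'"
  unfolding minor_def by (rule arg_cong[where f = det], rule eq_matI) (use assms in auto)

lemma minor_linear_last_row:
  assumes "r = Suc q"
  shows "minor r (v(q := \<lambda>c. a * x c + b * y c)) g =
    a * minor r (v(q := x)) g + b * minor r (v(q := y)) g"
proof -
  have "minor q (v(q := z)) h = minor q v h" for z h
    by (rule minor_cong) auto
  thus ?thesis
    unfolding assms minor_expand_row
    by (simp add: sum_distrib_left sum.distrib[symmetric] algebra_simps)
qed

text \<open>This measures how the sum of the row indices changes when a selected row is exchanged
  for another one.\<close>

lemma sum_drop_row:
  fixes h :: "nat \<Rightarrow> 'a::comm_monoid_add"
  assumes "s \<le> r"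
  shows "sum (drop_row s h) {..<r} + h s = sum h {..r}"
proof -
  have "sum (drop_row s h) {..<r} = sum h (insert_index s ` {..<r})"
    by (subst sum.reindex)
       (auto simp: inj_on_def insert_index_def drop_row_def intro!: sum.cong split: if_splits)
  also have "insert_index s ` {..<r} = {..r} - {s}"
  proof (intro equalityI subsetI)
    fix x assume "x \<in> {..r} - {s}"
    thus "x \<in> insert_index s ` {..<r}"
      using assms by (intro image_eqI[of _ _ "if x < s then x else x - 1"]) (auto simp: insert_index_def)
  qed (use assms in \<open>auto simp: insert_index_def\<close>)
  finally show ?thesis
    using assms by (simp add: sum.remove[of "{..r}" s h] add.commute)
qed

text \<open>Dropping row \<open>s < r\<close> moves the appended row from position \<open>r\<close>
  to the last position \<open>r - 1\<close>, where linearity is available.\<close>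

lemma minor_drop_row_linear:
  assumes "s < r"
  shows "minor r (drop_row s (v(r := \<lambda>c. a * x c + b * y c))) g =
    a * minor r (drop_row s (v(r := x))) g + b * minor r (drop_row s (v(r := y))) g"
proof -
  obtain q where q: "r = Suc q" using less_imp_Suc_add[OF assms] by blast
  have *: "minor r (drop_row s (v(r := w))) g = minor r ((drop_row s v)(q := w)) g" for w
    by (rule minor_cong) (use assms q in \<open>auto simp: drop_row_def\<close>)
  show ?thesis unfolding * by (rule minor_linear_last_row[OF q])
qed

text \<open>Integrality is asked of the combined row, while \<alpha> and \<beta> are arbitrary
  rationals. The cutoff \<open>l\<close> reflects the order of a refutation: only lines before step
  \<open>l\<close> may be assumed to vanish modulo \<open>p\<close>. The vector \<open>y\<close>
  will hold the values of the monomials.\<close>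

definition combination_closed :: "int \<Rightarrow> nat set \<Rightarrow> 'c set \<Rightarrow> (nat \<Rightarrow> 'c \<Rightarrow> rat) \<Rightarrow> bool" where
  "combination_closed p K J A \<longleftrightarrow> (\<forall>j k l \<alpha> \<beta> y. j \<in> K \<longrightarrow> k \<in> K \<longrightarrow> j < l \<longrightarrow> k < l \<longrightarrow>
     (\<forall>c\<in>J. \<alpha> * A j c + \<beta> * A k c \<in> p_integral p) \<longrightarrow>
     (\<forall>i\<in>K. i < l \<longrightarrow> (\<Sum>c\<in>J. A i c * y c) \<in> p_ideal p) \<longrightarrow>
     (\<Sum>c\<in>J. (\<alpha> * A j c + \<beta> * A k c) * y c) \<in> p_ideal p)"

text \<open>The integer \<open>z\<close> is a nonzero minor of maximal size, and among those one with the smallest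
  possible row indices. Maximality makes every row a combination of the selected ones, with
  denominator \<open>z\<close> by Cramer's rule; minimality ensures that only selected rows of smaller or equal
  index take part.\<close>

lemma ex_controlling_minor:
  fixes A :: "nat \<Rightarrow> 'c \<Rightarrow> int"
  assumes K: "finite K" and J: "finite J"
    and nz: "\<And>j. j \<in> K \<Longrightarrow> 1 \<le> (\<Sum>c\<in>J. \<bar>A j c\<bar>)"
  obtains z :: int where "z \<noteq> 0" "\<bar>z\<bar> \<le> (\<Prod>j\<in>K. \<Sum>c\<in>J. \<bar>A j c\<bar>)"
    "\<And>p. prime p \<Longrightarrow> \<not> p dvd z \<Longrightarrow> combination_closed p K J (\<lambda>j c. of_int (A j c))"
proof -
  define P where "P r f g \<longleftrightarrow> f ` {..<r} \<subseteq> K \<and> g ` {..<r} \<subseteq> J \<and> minor r (\<lambda>s. A (f s)) g \<noteq> 0"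
    for r and f :: "nat \<Rightarrow> nat" and g :: "nat \<Rightarrow> 'c"
  have inj_f: "inj_on f {..<r}" if P: "P r f g" for r f g
  proof (rule inj_onI)
    fix i j assume "i \<in> {..<r}" "j \<in> {..<r}" "f i = f j"
    thus "i = j" using minor_eq_0_rows[of i r j "\<lambda>s. A (f s)" g] P unfolding P_def by auto
  qed
  have inj_g: "inj_on g {..<r}" if P: "P r f g" for r f g
  proof (rule inj_onI)
    fix i j assume "i \<in> {..<r}" "j \<in> {..<r}" "g i = g j"
    thus "i = j" using minor_eq_0_cols[of i r j g "\<lambda>s. A (f s)"] P unfolding P_def by auto
  qed
  \<comment> \<open>The empty minor is 1.\<close>
  have ex: "\<exists>r f g. P r f g" by (rule exI[of _ 0]) (simp add: P_def minor_leibniz)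
  have le_card: "r \<le> card K" if ex: "\<exists>f g. P r f g" for r
  proof -
    obtain f g where P: "P r f g" using ex by blast
    hence "f ` {..<r} \<subseteq> K" by (simp add: P_def)
    hence "card {..<r} \<le> card K" by (rule card_inj_on_le[OF inj_f[OF P] _ K])
    thus ?thesis by simp
  qed
  define Q where "Q r \<longleftrightarrow> (\<exists>f g. P r f g)" for r
  define r where "r = (GREATEST r. Q r)"
  have "Q r" unfolding r_def
    by (rule GreatestI_ex_nat[where b = "card K"]) (use ex le_card in \<open>unfold Q_def, blast+\<close>)
  moreover have Q_le: "r' \<le> r" if "Q r'" for r' unfolding r_def using that
    by (rule Greatest_le_nat[where b = "card K"]) (use le_card in \<open>unfold Q_def, blast\<close>)
  have max: "r' \<le> r" if "\<exists>f g. P r' f g" for r'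
    using Q_le[of r'] that unfolding Q_def by blast
  ultimately have "\<exists>f g. P r f g" unfolding Q_def by blast
  then obtain f0 g where "P r f0 g" by blast
  \<comment> \<open>The columns stay fixed while the sum of the row indices is minimized.\<close>
  then obtain f where f: "P r f g" and min: "\<And>f'. P r f' g \<Longrightarrow> sum f {..<r} \<le> sum f' {..<r}"
    using ex_has_least_nat[of "\<lambda>f. P r f g" f0 "\<lambda>f. sum f {..<r}"] by auto
  define z where "z = minor r (\<lambda>s. A (f s)) g"
  define F where "F s c = (of_int (A (f s) c) :: rat)" for s c
  have z: "of_int z = minor r F g" unfolding z_def F_def by (rule minor_of_int[symmetric])
  show ?thesis
  proof (rule that)
    show "z \<noteq> 0" using f by (simp add: P_def z_def)
    have "\<bar>z\<bar> \<le> (\<Prod>s<r. \<Sum>t<r. \<bar>A (f s) (g t)\<bar>)" unfolding z_def by (rule abs_minor_le)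
    also have "\<dots> \<le> (\<Prod>s<r. \<Sum>c\<in>J. \<bar>A (f s) c\<bar>)"
    proof (intro prod_mono conjI sum_nonneg abs_ge_zero)
      fix s
      have "(\<Sum>t<r. \<bar>A (f s) (g t)\<bar>) = (\<Sum>c\<in>g ` {..<r}. \<bar>A (f s) c\<bar>)"
        using inj_g[OF f] by (simp add: sum.reindex)
      also have "\<dots> \<le> (\<Sum>c\<in>J. \<bar>A (f s) c\<bar>)" using f J by (intro sum_mono2) (auto simp: P_def)
      finally show "(\<Sum>t<r. \<bar>A (f s) (g t)\<bar>) \<le> (\<Sum>c\<in>J. \<bar>A (f s) c\<bar>)" .
    qed
    also have "\<dots> = (\<Prod>j\<in>f ` {..<r}. \<Sum>c\<in>J. \<bar>A j c\<bar>)"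
      using inj_f[OF f] by (simp add: prod.reindex)
    also have "\<dots> \<le> (\<Prod>j\<in>K. \<Sum>c\<in>J. \<bar>A j c\<bar>)"
      using f K nz by (intro prod_mono2) (auto simp: P_def intro: order_trans[OF zero_le_one])
    finally show "\<bar>z\<bar> \<le> \<dots>" .
  next
    fix p :: int assume p: "prime p" "\<not> p dvd z"
    show "combination_closed p K J (\<lambda>j c. of_int (A j c))"
      unfolding combination_closed_def
    proof (intro allI impI)
      fix j k l :: nat and a b :: rat and y :: "'c \<Rightarrow> rat"
      assume jk: "j \<in> K" "k \<in> K" "j < l" "k < l"
        and int: "\<forall>c\<in>J. a * of_int (A j c) + b * of_int (A k c) \<in> p_integral p"
        and y: "\<forall>i\<in>K. i < l \<longrightarrow> (\<Sum>c\<in>J. of_int (A i c) * y c) \<in> p_ideal p"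
      define row where "row i c = (of_int (A i c) :: rat)" for i c
      define T where "T c = a * row j c + b * row k c" for c
      \<comment> \<open>These are the cofactors along the last column after row \<open>v\<close> and
        one further column are appended; they do not depend on that column.\<close>
      define \<kappa> where "\<kappa> v s = (-1) ^ (r + s) * minor r (drop_row s (F(r := v))) g" for v s
      have \<kappa>_lin: "\<kappa> T s = a * \<kappa> (row j) s + b * \<kappa> (row k) s" if s: "s < r" for s
        using minor_drop_row_linear[OF s, of F a "row j" b "row k" g]
        unfolding \<kappa>_def T_def[abs_def] by (simp only: distrib_left mult.left_commute)
      \<comment> \<open>By maximality of \<open>r\<close>, every minor bordered by a row of
        \<open>K\<close> and a column of \<open>J\<close> vanishes.\<close>
      have bordered: "minor (Suc r) (F(r := row i)) (g(r := c)) = 0" if "i \<in> K" "c \<in> J" for i c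
      proof -
        have "\<not> P (Suc r) (f(r := i)) (g(r := c))" using max[of "Suc r"] by auto
        hence "minor (Suc r) (\<lambda>s. A ((f(r := i)) s)) (g(r := c)) = 0"
          using f that unfolding P_def by (auto simp: lessThan_Suc)
        hence "minor (Suc r) (\<lambda>s c. of_int (A ((f(r := i)) s) c) :: rat) (g(r := c)) = 0"
          by (simp only: minor_of_int of_int_0)
        moreover have "(\<lambda>s c. of_int (A ((f(r := i)) s) c) :: rat) = F(r := row i)"
          by (auto simp: F_def row_def fun_eq_iff)
        ultimately show ?thesis by simp
      qed
      \<comment> \<open>Cramer's rule: expand the vanishing bordered minor along its last column,
        where the cofactor of the corner is \<open>z\<close>.\<close>
      have expand: "of_int z * T c = - (\<Sum>s<r. \<kappa> T s * F s c)" if c: "c \<in> J" for c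
      proof -
        have "minor (Suc r) (F(r := T)) (g(r := c)) = 0"
          using minor_linear_last_row[of "Suc r" r F a "row j" b "row k" "g(r := c)"]
          by (simp add: bordered jk c T_def[abs_def])
        moreover have "minor r v (g(r := c)) = minor r v g" for v :: "nat \<Rightarrow> 'c \<Rightarrow> rat"
          by (rule minor_cong) auto
        moreover have "minor r (drop_row r (F(r := T))) g = of_int z"
          unfolding z by (rule minor_cong) (auto simp: drop_row_def)
        ultimately have "0 = T c * of_int z + (\<Sum>s<r. F s c * \<kappa> T s)"
          unfolding minor_expand_col \<kappa>_def by (simp add: lessThan_Suc_atMost[symmetric])
        thus ?thesis by (simp add: algebra_simps eq_neg_iff_add_eq_0)
      qed
      \<comment> \<open>Up to sign this cofactor is the minor with the selected row
        \<open>f s\<close> exchanged for row \<open>i\<close>. If it were nonzero, the exchange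
        would lower the sum of the row indices.\<close>
      have \<kappa>_zero: "\<kappa> (row i) s = 0" if "s < r" "i \<in> K" "i < f s" for i s
      proof -
        define f' where "f' = drop_row s (f(r := i))"
        have "sum f' {..<r} + f s = sum (f(r := i)) {..r}"
          unfolding f'_def using sum_drop_row[of s r "f(r := i)"] that by simp
        also have "\<dots> = sum f {..<r} + i" by (simp add: lessThan_Suc_atMost[symmetric])
        finally have "sum f' {..<r} < sum f {..<r}" using that by linarith
        hence "\<not> P r f' g" using min[of f'] by linarith
        moreover have "f' ` {..<r} \<subseteq> K"
          using f that by (auto simp: f'_def P_def drop_row_def)
        ultimately have "minor r (\<lambda>s. A (f' s)) g = 0" using f by (simp add: P_def)
        hence "minor r (\<lambda>s c. of_int (A (f' s) c) :: rat) g = 0" by (simp only: minor_of_int of_int_0)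
        moreover have "(\<lambda>s c. of_int (A (f' s) c) :: rat) = drop_row s (F(r := row i))"
          by (auto simp: F_def row_def fun_eq_iff f'_def drop_row_def)
        ultimately show ?thesis by (simp add: \<kappa>_def)
      qed
      have gJ: "g t \<in> J" if "t < r" for t using f that by (auto simp: P_def)
      \<comment> \<open>The matrix of this cofactor contains only integers and entries of
        \<open>T\<close>, which are p-integral by assumption.\<close>
      have \<kappa>_int: "\<kappa> T s \<in> p_integral p" if "s < r" for s
        unfolding \<kappa>_def
      proof (intro p_integral_mult p_integral_power p_integral_minus p_integral_1 minor_p_integral p)
        fix s' t assume "s' < r" "t < r"
        thus "drop_row s (F(r := T)) s' (g t) \<in> p_integral p"
          using int gJ[of t] p by (auto simp: drop_row_def F_def T_def row_def p_integral_of_int)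
      qed
      have "of_int z * (\<Sum>c\<in>J. T c * y c) = (\<Sum>c\<in>J. of_int z * T c * y c)"
        by (simp add: sum_distrib_left mult.assoc)
      also have "\<dots> = (\<Sum>c\<in>J. - (\<Sum>s<r. \<kappa> T s * F s c) * y c)" using expand by simp
      also have "\<dots> = - (\<Sum>s<r. (\<Sum>c\<in>J. F s c * y c) * \<kappa> T s)"
        by (simp add: sum_negf sum_distrib_right sum_distrib_left sum.swap[of _ J] mult_ac)
      also have "\<dots> \<in> p_ideal p"
      proof (intro p_ideal_minus p_ideal_sum p)
        fix s assume s: "s \<in> {..<r}"
        show "(\<Sum>c\<in>J. F s c * y c) * \<kappa> T s \<in> p_ideal p"
        proof (cases "f s < l")
          case True
          thus ?thesis using s f p y \<kappa>_int
            by (intro p_ideal_mult) (auto simp: P_def F_def)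
        next
          \<comment> \<open>Here \<open>j\<close> and \<open>k\<close> lie below \<open>l\<close>,
            hence below \<open>f s\<close>, so both of their cofactors vanish, and by linearity so
            does that of \<open>T\<close>.\<close>
          case False
          hence "\<kappa> T s = 0" using s jk by (simp add: \<kappa>_lin \<kappa>_zero)
          thus ?thesis using p by (simp add: p_ideal_0)
        qed
      qed
      finally have "of_int z * (\<Sum>c\<in>J. T c * y c) * inverse (of_int z) \<in> p_ideal p"
        using p by (intro p_ideal_mult[of p "_ * _"] p_integral_inverse)
          (auto simp: p_integral_of_int of_int_in_p_ideal_iff)
      moreover have "of_int z * x * inverse (of_int z) = x" for x :: rat
        using p by (cases "z = 0") auto
      ultimately have "(\<Sum>c\<in>J. T c * y c) \<in> p_ideal p" by simp
      thus "(\<Sum>c\<in>J. (a * of_int (A j c) + b * of_int (A k c)) * y c) \<in> p_ideal p"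
        by (simp add: T_def row_def)
    qed
  qed
qed

section \<open>Heights and linear combinations\<close>

text \<open>The product of numerator and denominator replaces the usual maximum: a prime divides it
  exactly if it divides one of the two, and its logarithm is the bit size without rounding. At 0 it
  is 0, where the logarithm is 0 by convention.\<close>

definition height :: "rat \<Rightarrow> int" where
  "height q = \<bar>fst (quotient_of q)\<bar> * snd (quotient_of q)"

abbreviation lg_height :: "rat \<Rightarrow> real" where
  "lg_height q \<equiv> log 2 (real_of_int (height q))"

lemma height_ge_1: "q \<noteq> 0 \<Longrightarrow> 1 \<le> height q"
proof -
  assume q: "q \<noteq> 0"
  obtain a b where ab: "quotient_of q = (a, b)" by (cases "quotient_of q")
  hence "b > 0" "q = of_int a / of_int b"
    using quotient_of_denom_pos quotient_of_div by blast+
  hence "\<bar>a\<bar> * b > 0" using q by simp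
  thus "1 \<le> height q" by (simp add: height_def ab)
qed

lemma lg_height_nonneg: "0 \<le> lg_height q"
  using height_ge_1[of q] by (cases "q = 0") (simp_all add: height_def log_def flip: of_int_mult of_int_abs)

lemma abs_eq_1_of_height_eq_1:
  assumes "height q = 1"
  shows "\<bar>q\<bar> = 1"
proof -
  obtain a b where ab: "quotient_of q = (a, b)" by (cases "quotient_of q")
  have b: "b > 0" using ab quotient_of_denom_pos by blast
  have "\<bar>a\<bar> * b = 1" using assms by (simp add: height_def ab)
  hence "\<bar>a\<bar> = 1" "b = 1" using b by (auto simp: zmult_eq_1_iff)
  moreover have "q = of_int a / of_int b" using ab quotient_of_div by blast
  ultimately show ?thesis by (metis abs_divide div_by_1 of_int_1 of_int_abs abs_one)
qed

lemma not_dvd_height_unit: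
  assumes "prime p" "\<not> p dvd height x"
  shows "x \<in> p_integral p" "x \<notin> p_ideal p"
  using assms unit_p_integral[of p x] unit_not_p_ideal[of p x]
  by (auto simp: height_def prime_dvd_mult_iff)

text \<open>\<open>ratio_num x y\<close> and \<open>ratio_den x y\<close> represent \<open>x / y\<close> as a possibly unreduced fraction.\<close>

definition ratio_num :: "rat \<Rightarrow> rat \<Rightarrow> int" where
  "ratio_num x y = fst (quotient_of x) * snd (quotient_of y)"

definition ratio_den :: "rat \<Rightarrow> rat \<Rightarrow> int" where
  "ratio_den x y = snd (quotient_of x) * fst (quotient_of y)"

lemma ratio_num_den:
  assumes "y \<noteq> 0"
  shows "x / y = of_int (ratio_num x y) / of_int (ratio_den x y)"
proof -
  have "x = of_int (fst (quotient_of x)) / of_int (snd (quotient_of x))" for x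
    by (rule quotient_of_div) simp
  hence "x / y = (of_int (fst (quotient_of x)) / of_int (snd (quotient_of x))) /
      (of_int (fst (quotient_of y)) / of_int (snd (quotient_of y)))" by metis
  thus ?thesis by (simp add: ratio_num_def ratio_den_def)
qed

lemma abs_ratio_num_den: "\<bar>ratio_num x y\<bar> * \<bar>ratio_den x y\<bar> = height x * height y"
proof -
  have "snd (quotient_of x) > 0" for x by (rule quotient_of_denom_pos') 
  hence "\<bar>snd (quotient_of x)\<bar> = snd (quotient_of x)" for x by (metis abs_of_pos)
  thus ?thesis by (simp add: ratio_num_def ratio_den_def height_def abs_mult)
qed

lemma ratio_num_den_nonzero:
  assumes "x \<noteq> 0" "y \<noteq> 0"
  shows "ratio_num x y \<noteq> 0" "ratio_den x y \<noteq> 0"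
  using abs_ratio_num_den[of x y] height_ge_1[OF assms(1)] height_ge_1[OF assms(2)] by auto

text \<open>Only 1 and -1 have height 1. Thus a coefficient whose absolute value differs from that
  of the pivot pays, together with the pivot, for at least one bit.\<close>

lemma heights_ge_2:
  assumes "x \<noteq> 0" "y \<noteq> 0" "\<bar>x\<bar> \<noteq> \<bar>y\<bar>"
  shows "2 \<le> height x * height y"
proof -
  have ge: "1 \<le> height x" "1 \<le> height y" using assms height_ge_1 by auto
  show ?thesis
  proof (cases "height x = 1")
    case True
    hence "height y \<noteq> 1" using assms(3) abs_eq_1_of_height_eq_1 by metis
    thus ?thesis using ge True by simp
  next
    case False
    thus ?thesis using ge mult_mono[of 2 "height x" 1 "height y"] by simp
  qed
qed

section \<open>Estimates for sums and products of integers\<close>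

lemma log_prod_of_int:
  fixes f :: "'c \<Rightarrow> int"
  assumes "\<And>i. i \<in> I \<Longrightarrow> 0 < f i"
  shows "log b (real_of_int (prod f I)) = (\<Sum>i\<in>I. log b (real_of_int (f i)))"
proof (cases "finite I")
  case True
  have "f i \<noteq> 0" if "i \<in> I" for i using assms[OF that] by simp
  thus ?thesis using True by (simp add: log_def ln_prod sum_divide_distrib)
qed simp

text \<open>This lets the heights alone absorb the number of columns in a row sum. The chain is u +
  v \<le> uv + 1 \<le> 2uv \<le> (uv)^2, starting from (u - 1)(v - 1) \<ge> 0.\<close>

lemma add_le_square_mult:
  fixes u v :: int
  assumes "1 \<le> u" "1 \<le> v" "2 \<le> u * v"
  shows "u + v \<le> (u * v)\<^sup>2"
proof -
  have "0 \<le> (u - 1) * (v - 1)" using assms by simp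
  hence "u + v \<le> u * v + 1" by (simp add: algebra_simps)
  also have "\<dots> \<le> (u * v) * 2" using assms by simp
  also have "\<dots> \<le> (u * v) * (u * v)" using assms by (intro mult_left_mono) auto
  finally show ?thesis by (simp add: power2_eq_square)
qed

text \<open>The left side collects those terms of the expanded product that contain at most one
  factor \<open>u i\<close>.\<close>

lemma prod_plus_sum_prod_le:
  fixes u v :: "'c \<Rightarrow> 'a::linordered_idom"
  assumes "finite N" "\<And>i. i \<in> N \<Longrightarrow> 0 \<le> u i" "\<And>i. i \<in> N \<Longrightarrow> 0 \<le> v i"
  shows "prod v N + (\<Sum>i\<in>N. u i * prod v (N - {i})) \<le> (\<Prod>i\<in>N. u i + v i)"
  using assms
proof (induction N rule: finite_induct)
  case (insert x N)
  have "prod v (insert x N - {i}) = v x * prod v (N - {i})" if "i \<in> N" for i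
    using insert that by (subst insert_Diff_if) auto
  hence "(\<Sum>i\<in>insert x N. u i * prod v (insert x N - {i})) =
      u x * prod v N + v x * (\<Sum>i\<in>N. u i * prod v (N - {i}))"
    using insert by (simp add: sum_distrib_left mult.left_commute)
  hence "prod v (insert x N) + (\<Sum>i\<in>insert x N. u i * prod v (insert x N - {i})) =
      u x * prod v N + v x * (prod v N + (\<Sum>i\<in>N. u i * prod v (N - {i})))"
    using insert by (simp add: algebra_simps)
  also have "\<dots> \<le> u x * (\<Prod>i\<in>N. u i + v i) + v x * (\<Prod>i\<in>N. u i + v i)"
    using insert by (intro add_mono mult_left_mono prod_mono) auto
  finally show ?case using insert by (simp add: algebra_simps)
qed simp

text \<open>Collapsing the columns outside \<open>N\<close>, on which all the rows are proportional, into
  \<open>i0\<close> keeps the number of columns below the heights of the rows.\<close>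

lemma ex_controlling_integer_group:
  fixes a :: "nat \<Rightarrow> 'c \<Rightarrow> rat"
  assumes K: "finite K" and M: "finite M" and i0: "i0 \<in> M"
    and nz: "\<And>j c. j \<in> K \<Longrightarrow> c \<in> M \<Longrightarrow> a j c \<noteq> 0"
    and N: "\<And>j. j \<in> K \<Longrightarrow> N = {c \<in> M. \<bar>a j c\<bar> \<noteq> \<bar>a j i0\<bar>}"
    and w: "\<And>j c. j \<in> K \<Longrightarrow> c \<in> M - N \<Longrightarrow> a j c = w c * a j i0"
  obtains z :: int where "z \<noteq> 0"
    "log 2 \<bar>z\<bar> \<le> 2 * (\<Sum>j\<in>K. \<Sum>c\<in>M. lg_height (a j c) + lg_height (a j i0))"
    "\<And>p. \<lbrakk>prime p; \<not> p dvd z; \<forall>i\<in>K. \<not> p dvd height (a i i0)\<rbrakk>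
      \<Longrightarrow> combination_closed p K M a"
proof (cases "K = {}")
  case True
  thus thesis by (intro that[of 1]) (auto simp: combination_closed_def)
next
  case False
  then obtain j0 where "j0 \<in> K" by blast
  have NM: "N \<subseteq> M" "i0 \<notin> N" using N[OF \<open>j0 \<in> K\<close>] by auto
  have fN: "finite N" using NM M finite_subset by blast
  define u where "u j c = ratio_num (a j c) (a j i0)" for j c
  define v where "v j c = ratio_den (a j c) (a j i0)" for j c
  \<comment> \<open>Row \<open>j\<close> is divided by its pivot \<open>a j i0\<close> and
    multiplied by the common denominator \<open>d j\<close> of the entries in \<open>N\<close>;
    \<open>\<mu> j\<close> is the total factor and \<open>A\<close> the resulting integer
    matrix.\<close>
  define d where "d j = prod (v j) N" for j
  define A where "A j c = (if c = i0 then d j else u j c * prod (v j) (N - {c}))" for j c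
  define J where "J = insert i0 N"
  define \<mu> where "\<mu> j = of_int (d j) / a j i0" for j
  have v0: "v j c \<noteq> 0" and u0: "u j c \<noteq> 0" if "j \<in> K" "c \<in> M" for j c
    using ratio_num_den_nonzero[OF nz[OF that] nz[OF that(1) i0]] by (simp_all add: u_def v_def)
  have d0: "d j \<noteq> 0" if "j \<in> K" for j
    using v0[OF that] NM fN by (auto simp: d_def)
  have A: "of_int (A j c) = \<mu> j * a j c" if "j \<in> K" "c \<in> J" for j c
  proof (cases "c = i0")
    case True
    thus ?thesis using nz[OF that(1) i0] by (simp add: A_def \<mu>_def)
  next
    case False
    hence c: "c \<in> N" using that by (simp add: J_def)
    have "of_int (d j) * (a j c / a j i0) = of_int (d j) * (of_int (u j c) / of_int (v j c))"
      using ratio_num_den[OF nz[OF that(1) i0]] by (simp add: u_def v_def)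
    moreover have "d j = v j c * prod (v j) (N - {c})"
      unfolding d_def using fN c by (rule prod.remove)
    ultimately show ?thesis
      using False v0[OF that(1), of c] c NM by (auto simp: A_def \<mu>_def)
  qed
  have l1: "(\<Sum>c\<in>J. \<bar>A j c\<bar>) \<le> (\<Prod>c\<in>N. (height (a j c) * height (a j i0))\<^sup>2)" if j: "j \<in> K" for j
  proof -
    have "(\<Sum>c\<in>J. \<bar>A j c\<bar>) = \<bar>d j\<bar> + (\<Sum>c\<in>N. \<bar>A j c\<bar>)"
      unfolding J_def using NM fN by (subst sum.insert) (auto simp: A_def)
    also have "\<dots> = (\<Prod>c\<in>N. \<bar>v j c\<bar>) + (\<Sum>c\<in>N. \<bar>u j c\<bar> * (\<Prod>c\<in>N - {c}. \<bar>v j c\<bar>))"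
      using NM by (intro arg_cong2[where f = "(+)"] sum.cong) (auto simp: A_def d_def abs_mult abs_prod)
    also have "\<dots> \<le> (\<Prod>c\<in>N. \<bar>u j c\<bar> + \<bar>v j c\<bar>)"
      using fN by (intro prod_plus_sum_prod_le) auto
    also have "\<dots> \<le> (\<Prod>c\<in>N. (height (a j c) * height (a j i0))\<^sup>2)"
    proof (intro prod_mono conjI)
      fix c assume c: "c \<in> N"
      hence cM: "c \<in> M" using NM by blast
      have "\<bar>u j c\<bar> + \<bar>v j c\<bar> \<le> (\<bar>u j c\<bar> * \<bar>v j c\<bar>)\<^sup>2"
      proof (rule add_le_square_mult)
        show "2 \<le> \<bar>u j c\<bar> * \<bar>v j c\<bar>"
          unfolding u_def v_def abs_ratio_num_den
          using heights_ge_2[OF nz[OF j cM] nz[OF j i0]] c N[OF j] by blast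
      qed (use u0[OF j cM] v0[OF j cM] in auto)
      thus "\<bar>u j c\<bar> + \<bar>v j c\<bar> \<le> (height (a j c) * height (a j i0))\<^sup>2"
        unfolding u_def v_def abs_ratio_num_den .
    qed auto
    finally show ?thesis .
  qed
  have l1_pos: "1 \<le> (\<Sum>c\<in>J. \<bar>A j c\<bar>)" if "j \<in> K" for j
  proof -
    have "1 \<le> \<bar>A j i0\<bar>" using d0[OF that] by (simp add: A_def)
    also have "\<dots> \<le> (\<Sum>c\<in>J. \<bar>A j c\<bar>)"
      using fN by (intro member_le_sum) (auto simp: J_def)
    finally show ?thesis .
  qed
  have fJ: "finite J" using fN by (simp add: J_def)
  obtain z :: int where z: "z \<noteq> 0" "\<bar>z\<bar> \<le> (\<Prod>j\<in>K. \<Sum>c\<in>J. \<bar>A j c\<bar>)"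
    and control: "\<And>p. prime p \<Longrightarrow> \<not> p dvd z \<Longrightarrow> combination_closed p K J (\<lambda>j c. of_int (A j c))"
    by (rule ex_controlling_minor[of K J A, OF K fJ l1_pos]) (assumption, rule that)
  show thesis
  proof (rule that)
    show "z \<noteq> 0" by fact
    have H: "1 \<le> height (a j c) * height (a j i0)" if "j \<in> K" "c \<in> M" for j c
      using height_ge_1[OF nz[OF that]] height_ge_1[OF nz[OF that(1) i0]]
        mult_mono[of 1 "height (a j c)" 1 "height (a j i0)"] by simp
    have "\<bar>z\<bar> \<le> (\<Prod>j\<in>K. \<Prod>c\<in>N. (height (a j c) * height (a j i0))\<^sup>2)"
      using z(2) l1 l1_pos
      by (elim order_trans) (intro prod_mono conjI, auto intro: order_trans[OF zero_le_one])
    also have "\<dots> \<le> (\<Prod>j\<in>K. \<Prod>c\<in>M. (height (a j c) * height (a j i0))\<^sup>2)"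
      using NM M H by (intro prod_mono prod_mono2 conjI prod_nonneg) (auto simp: one_le_power)
    finally have "real_of_int \<bar>z\<bar> \<le> real_of_int (\<Prod>j\<in>K. \<Prod>c\<in>M. (height (a j c) * height (a j i0))\<^sup>2)"
      by (simp only: of_int_le_iff)
    hence "log 2 \<bar>z\<bar> \<le> log 2 (real_of_int (\<Prod>j\<in>K. \<Prod>c\<in>M. (height (a j c) * height (a j i0))\<^sup>2))"
      using z(1) by (intro log_mono) auto
    also have "\<dots> = (\<Sum>j\<in>K. \<Sum>c\<in>M. 2 * (lg_height (a j c) + lg_height (a j i0)))"
    proof -
      have pos: "0 < height (a j c)" if "j \<in> K" "c \<in> M" for j c
        using height_ge_1[OF nz[OF that]] by simp
      have "log 2 (real_of_int ((height (a j c) * height (a j i0))\<^sup>2)) =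
          2 * (lg_height (a j c) + lg_height (a j i0))" if "j \<in> K" "c \<in> M" for j c
        using pos[OF that] pos[OF that(1) i0] by (simp add: log_nat_power log_mult)
      moreover have "0 < (height (a j c) * height (a j i0))\<^sup>2" if "j \<in> K" "c \<in> M" for j c
        using pos[OF that] pos[OF that(1) i0] by simp
      ultimately show ?thesis by (simp add: log_prod_of_int prod_pos del: of_int_power of_int_mult of_int_prod)
    qed
    finally show "log 2 \<bar>z\<bar> \<le> 2 * (\<Sum>j\<in>K. \<Sum>c\<in>M. lg_height (a j c) + lg_height (a j i0))"
      by (simp add: sum_distrib_left)
  next
    fix p :: int
    assume p: "prime p" "\<not> p dvd z" and unit: "\<forall>i\<in>K. \<not> p dvd height (a i i0)"
    show "combination_closed p K M a"
      unfolding combination_closed_def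
    proof (intro allI impI)
      fix j k l :: nat and \<alpha> \<beta> :: rat and y :: "'c \<Rightarrow> rat"
      assume jk: "j \<in> K" "k \<in> K" "j < l" "k < l"
        and int: "\<forall>c\<in>M. \<alpha> * a j c + \<beta> * a k c \<in> p_integral p"
        and y: "\<forall>i\<in>K. i < l \<longrightarrow> (\<Sum>c\<in>M. a i c * y c) \<in> p_ideal p"
      \<comment> \<open>The pivot column takes over the weighted values of all collapsed columns, so
        that sums over \<open>J\<close> with \<open>y'\<close> agree with sums over \<open>M\<close>
        with \<open>y\<close>.\<close>
      define y' where "y' c = (if c = i0 then \<Sum>c\<in>M - N. w c * y c else y c)" for c
      have collapse: "(\<Sum>c\<in>J. b c * y' c) = (\<Sum>c\<in>M. b c * y c)"
        if b: "\<And>c. c \<in> M - N \<Longrightarrow> b c = w c * b i0" for b :: "'c \<Rightarrow> rat"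
      proof -
        have "(\<Sum>c\<in>J. b c * y' c) = b i0 * y' i0 + (\<Sum>c\<in>N. b c * y' c)"
          unfolding J_def using NM fN by simp
        also have "(\<Sum>c\<in>N. b c * y' c) = (\<Sum>c\<in>N. b c * y c)"
          using NM by (intro sum.cong) (auto simp: y'_def)
        also have "b i0 * y' i0 = (\<Sum>c\<in>M - N. b c * y c)"
          unfolding y'_def by (simp add: sum_distrib_left b mult_ac)
        also have "\<dots> + (\<Sum>c\<in>N. b c * y c) = (\<Sum>c\<in>M. b c * y c)"
          using sum.subset_diff[OF NM(1) M] by metis
        finally show ?thesis .
      qed
      \<comment> \<open>The pivot is a unit at \<open>p\<close>, so passing to the integer rows
        preserves vanishing modulo \<open>p\<close>.\<close>
      have \<mu>_int: "\<mu> i \<in> p_integral p" if "i \<in> K" for i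
        unfolding \<mu>_def divide_inverse using p unit[rule_format, OF that] not_dvd_height_unit[of p "a i i0"]
        by (intro p_integral_mult p_integral_inverse p_integral_of_int) auto
      have \<mu>0: "\<mu> i \<noteq> 0" if "i \<in> K" for i
        using d0[OF that] nz[OF that i0] by (simp add: \<mu>_def)
      \<comment> \<open>The scalars absorb the row factors; they may fail to be p-integral, which
        \<open>combination_closed\<close> allows.\<close>
      have eq: "\<alpha> / \<mu> j * of_int (A j c) + \<beta> / \<mu> k * of_int (A k c) = \<alpha> * a j c + \<beta> * a k c"
        if "c \<in> J" for c using A[OF _ that] jk \<mu>0 by simp
      have JM: "J \<subseteq> M" using NM i0 by (auto simp: J_def)
      have "(\<Sum>c\<in>J. (\<alpha> / \<mu> j * of_int (A j c) + \<beta> / \<mu> k * of_int (A k c)) * y' c) \<in> p_ideal p"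
      proof (rule control[OF p, unfolded combination_closed_def, rule_format, OF jk])
        fix c assume "c \<in> J"
        thus "\<alpha> / \<mu> j * of_int (A j c) + \<beta> / \<mu> k * of_int (A k c) \<in> p_integral p"
          using eq int JM by auto
      next
        fix i assume i: "i \<in> K" "i < l"
        have "(\<Sum>c\<in>J. of_int (A i c) * y' c) = (\<Sum>c\<in>J. a i c * y' c) * \<mu> i"
          unfolding sum_distrib_right using A[OF i(1)] by (intro sum.cong) auto
        also have "(\<Sum>c\<in>J. a i c * y' c) = (\<Sum>c\<in>M. a i c * y c)"
          using w[OF i(1)] by (rule collapse)
        also have "\<dots> * \<mu> i \<in> p_ideal p"
          by (rule p_ideal_mult[OF p(1) y[rule_format, OF i] \<mu>_int[OF i(1)]])
        finally show "(\<Sum>c\<in>J. of_int (A i c) * y' c) \<in> p_ideal p" .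
      qed
      also have "(\<Sum>c\<in>J. (\<alpha> / \<mu> j * of_int (A j c) + \<beta> / \<mu> k * of_int (A k c)) * y' c) =
          (\<Sum>c\<in>J. (\<alpha> * a j c + \<beta> * a k c) * y' c)"
        using eq by (intro sum.cong) auto
      also have "\<dots> = (\<Sum>c\<in>M. (\<alpha> * a j c + \<beta> * a k c) * y c)"
      proof (rule collapse)
        fix c assume "c \<in> M - N"
        thus "\<alpha> * a j c + \<beta> * a k c = w c * (\<alpha> * a j i0 + \<beta> * a k i0)"
          using w[OF jk(1)] w[OF jk(2)] by (simp add: algebra_simps)
      qed
      finally show "(\<Sum>c\<in>M. (\<alpha> * a j c + \<beta> * a k c) * y c) \<in> p_ideal p" .
    qed
  qed
qed

text \<open>Cramer's rule: if some \<open>2 \<times> 2\<close> minor of the two vectors is a unit at \<open>p\<close>, then the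
  coefficients of a \<open>p\<close>-integral combination are \<open>p\<close>-integral.\<close>

lemma p_integral_combination_cases:
  fixes x y T :: "'c \<Rightarrow> rat"
  assumes p: "prime p" and T: "\<And>c. T c = \<alpha> * x c + \<beta> * y c"
    and int: "\<And>c. T c \<in> p_integral p"
    and x: "\<And>c. x c \<noteq> 0 \<Longrightarrow> x c \<in> p_integral p \<and> x c \<notin> p_ideal p"
    and y: "\<And>c. y c \<noteq> 0 \<Longrightarrow> y c \<in> p_integral p \<and> y c \<notin> p_ideal p"
  obtains (integral) \<alpha>' \<beta>' where "\<alpha>' \<in> p_integral p" "\<beta>' \<in> p_integral p"
      "\<And>c. T c = \<alpha>' * x c + \<beta>' * y c"
  | (proportional) "\<And>c. x c \<noteq> 0 \<longleftrightarrow> y c \<noteq> 0" "\<exists>c. x c \<noteq> 0"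
      "\<And>c d. x c * y d - x d * y c \<in> p_ideal p"
proof -
  have x_int: "x c \<in> p_integral p" and y_int: "y c \<in> p_integral p" for c
    using x[of c] y[of c] p_integral_0[OF p] by (cases "x c = 0"; cases "y c = 0"; simp)+
  have minor_int: "u \<in> p_integral p \<Longrightarrow> v \<in> p_integral p \<Longrightarrow> s \<in> p_integral p \<Longrightarrow> t \<in> p_integral p
    \<Longrightarrow> u * v - s * t \<in> p_integral p" for u v s t
    using p by (intro p_integral_diff p_integral_mult)
  note p0 = p_integral_0[OF p]
  consider (unit_minor) c d where "x c * y d - x d * y c \<notin> p_ideal p"
    | (x_zero) "\<And>c. x c = 0" | (y_zero) "\<And>c. y c = 0"
    | (minors) "\<And>c d. x c * y d - x d * y c \<in> p_ideal p" "\<exists>c. x c \<noteq> 0" "\<exists>c. y c \<noteq> 0"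
    by blast
  thus thesis
  proof cases
    case unit_minor
    define \<Delta> where "\<Delta> = x c * y d - x d * y c"
    have \<Delta>: "\<Delta> \<in> p_integral p" "\<Delta> \<notin> p_ideal p"
      using unit_minor minor_int[OF x_int y_int x_int y_int] by (auto simp: \<Delta>_def)
    hence \<Delta>0: "\<Delta> \<noteq> 0" using p_ideal_0[OF p] by auto
    have "\<alpha> * \<Delta> = T c * y d - T d * y c" "\<beta> * \<Delta> = x c * T d - x d * T c"
      by (simp_all add: T \<Delta>_def algebra_simps)
    hence "\<alpha> = (T c * y d - T d * y c) * inverse \<Delta>" "\<beta> = (x c * T d - x d * T c) * inverse \<Delta>"
      using \<Delta>0 by (simp_all add: field_simps)
    hence "\<alpha> \<in> p_integral p" "\<beta> \<in> p_integral p"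
      using p_integral_mult[OF p minor_int[OF int y_int int y_int] p_integral_inverse[OF p \<Delta>]]
        p_integral_mult[OF p minor_int[OF x_int int x_int int] p_integral_inverse[OF p \<Delta>]] by auto
    thus thesis using T by (rule integral)
  next
    case x_zero
    show thesis
    proof (cases "\<exists>c. y c \<noteq> 0")
      case True
      then obtain c where c: "y c \<noteq> 0" by blast
      hence "\<beta> = T c * inverse (y c)" by (simp add: T x_zero)
      hence "\<beta> \<in> p_integral p" using p_integral_mult[OF p int p_integral_inverse[OF p]] y[OF c] by auto
      thus thesis using integral[of 0 \<beta>] T x_zero p0 by simp
    next
      case False
      thus thesis using integral[of 0 0] T x_zero p0 by simp
    qed
  next
    case y_zero
    show thesis
    proof (cases "\<exists>c. x c \<noteq> 0")
      case True
      then obtain c where c: "x c \<noteq> 0" by blast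
      hence "\<alpha> = T c * inverse (x c)" by (simp add: T y_zero)
      hence "\<alpha> \<in> p_integral p" using p_integral_mult[OF p int p_integral_inverse[OF p]] x[OF c] by auto
      thus thesis using integral[of \<alpha> 0] T y_zero p0 by simp
    next
      case False
      thus thesis using integral[of 0 0] T y_zero p0 by simp
    qed
  next
    case minors
    obtain d e where d: "x d \<noteq> 0" and e: "y e \<noteq> 0" using minors by blast
    \<comment> \<open>Nonzero entries are units, so a zero of one vector facing a nonzero entry of
      the other would produce a minor that is a unit.\<close>
    have "x c = 0 \<longleftrightarrow> y c = 0" for c
    proof
      assume "x c = 0"
      hence "x d * y c \<in> p_ideal p" using minors(1)[of d c] by simp
      hence "y c \<in> p_ideal p" using p_ideal_prime_ideal[OF p x_int y_int] x[OF d] by blast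
      thus "y c = 0" using y by blast
    next
      assume "y c = 0"
      hence "x c * y e \<in> p_ideal p" using minors(1)[of c e] by simp
      hence "x c \<in> p_ideal p" using p_ideal_prime_ideal[OF p x_int y_int] y[OF e] by blast
      thus "x c = 0" using x by blast
    qed
    thus thesis using proportional minors by blast
  qed
qed

text \<open>The minimum is at most the average. Hence normalizing all lines with the same monomials
  at one position, with the pivot charged once per monomial, costs no more than the lines
  themselves.\<close>

lemma ex_cheap_index:
  fixes h :: "'a \<Rightarrow> 'c \<Rightarrow> real"
  assumes "finite M" "M \<noteq> {}"
  shows "\<exists>c0\<in>M. real (card M) * (\<Sum>j\<in>K. h j c0) \<le> (\<Sum>j\<in>K. \<Sum>c\<in>M. h j c)"
proof -
  let ?f = "\<lambda>c. \<Sum>j\<in>K. h j c"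
  obtain c0 where c0: "c0 \<in> M" "\<And>c. c \<in> M \<Longrightarrow> ?f c0 \<le> ?f c"
    using arg_min_if_finite(1)[OF assms, of ?f] arg_min_least[OF assms, of _ ?f] by metis
  have "real (card M) * ?f c0 \<le> (\<Sum>c\<in>M. ?f c)"
    using sum_bounded_below[of M "?f c0" ?f] c0(2) by simp
  also have "\<dots> = (\<Sum>j\<in>K. \<Sum>c\<in>M. h j c)" by (rule sum.swap)
  finally show ?thesis using c0(1) by blast
qed

text \<open>The numerator of \<open>(x / y)\<^sup>2 - 1\<close>, divisible by \<open>p\<close> if \<open>x / y\<close> is \<open>1\<close> or \<open>-1\<close> modulo \<open>p\<close>.\<close>

definition square_gap :: "rat \<Rightarrow> rat \<Rightarrow> int" where
  "square_gap x y = (ratio_num x y)\<^sup>2 - (ratio_den x y)\<^sup>2"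

lemma square_gap_nonzero:
  assumes "x \<noteq> 0" "y \<noteq> 0" "\<bar>x\<bar> \<noteq> \<bar>y\<bar>"
  shows "square_gap x y \<noteq> 0"
proof
  assume "square_gap x y = 0"
  hence "\<bar>ratio_num x y\<bar> = \<bar>ratio_den x y\<bar>"
    by (simp add: square_gap_def power2_eq_iff abs_eq_iff)
  hence "\<bar>x / y\<bar> = 1"
    unfolding ratio_num_den[OF assms(2)] abs_divide of_int_abs[symmetric]
    using ratio_num_den_nonzero[OF assms(1,2)] by simp
  thus False using assms by (simp add: abs_divide)
qed

lemma abs_square_gap_le:
  assumes "x \<noteq> 0" "y \<noteq> 0"
  shows "\<bar>square_gap x y\<bar> \<le> (height x * height y)\<^sup>2"
proof -
  define u where "u = \<bar>ratio_num x y\<bar>"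
  define v where "v = \<bar>ratio_den x y\<bar>"
  have uv: "1 \<le> u" "1 \<le> v" using ratio_num_den_nonzero[OF assms] by (auto simp: u_def v_def)
  hence "1 \<le> u\<^sup>2" "1 \<le> v\<^sup>2" by simp_all
  hence "u\<^sup>2 \<le> u\<^sup>2 * v\<^sup>2" "v\<^sup>2 \<le> u\<^sup>2 * v\<^sup>2"
    using mult_left_mono[of 1 "v\<^sup>2" "u\<^sup>2"] mult_right_mono[of 1 "u\<^sup>2" "v\<^sup>2"] by auto
  hence "\<bar>u\<^sup>2 - v\<^sup>2\<bar> \<le> (u * v)\<^sup>2"
    using \<open>1 \<le> u\<^sup>2\<close> \<open>1 \<le> v\<^sup>2\<close> by (simp add: power_mult_distrib abs_le_iff)
  thus ?thesis
    unfolding abs_ratio_num_den[symmetric] by (simp add: u_def v_def square_gap_def)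
qed

lemma square_gap_dvd:
  assumes p: "prime p" and y: "y \<noteq> 0" "\<not> p dvd height x" "\<not> p dvd height y"
    and eq: "x * x - y * y \<in> p_ideal p"
  shows "p dvd square_gap x y"
proof -
  let ?u = "ratio_num x y" and ?v = "ratio_den x y"
  have "\<not> p dvd height x * height y" using y p by (simp add: prime_dvd_mult_iff)
  hence v: "\<not> p dvd ?v\<^sup>2"
    unfolding abs_ratio_num_den[symmetric] using p by (auto simp: prime_dvd_power_iff)
  have "inverse y \<in> p_integral p"
    using p not_dvd_height_unit[OF p y(3)] by (intro p_integral_inverse)
  hence "(x * x - y * y) * (inverse y * inverse y) \<in> p_ideal p"
    using p eq by (intro p_ideal_mult[of p "_ - _"] p_integral_mult)
  also have "(x * x - y * y) * (inverse y * inverse y) = (x / y)\<^sup>2 - 1"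
    using y(1) by (simp add: field_simps power2_eq_square)
  also have "\<dots> = of_int (square_gap x y) / of_int (?v\<^sup>2)"
  proof -
    have "?v \<noteq> 0" using v by auto
    thus ?thesis
      unfolding ratio_num_den[OF y(1)] square_gap_def by (simp add: field_simps)
  qed
  finally show ?thesis using of_int_divide_in_p_ideal_iff[OF p v] by blast
qed

lemma sign_cases: "\<bar>x\<bar> = \<bar>y\<bar> \<Longrightarrow> \<exists>s\<in>{1, -1}. x = s * (y::rat)"
  by (auto simp: abs_eq_iff)

text \<open>The prime 2 is charged separately because opposite signs agree modulo 2.\<close>

lemma ex_controlling_integer:
  fixes a :: "nat \<Rightarrow> 'c \<Rightarrow> rat"
  assumes fin: "\<And>j. j < L \<Longrightarrow> finite {c. a j c \<noteq> 0}"
  obtains D :: int where "D \<noteq> 0"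
    "log 2 \<bar>D\<bar> \<le> 1 + 9 * (\<Sum>j<L. \<Sum>c | a j c \<noteq> 0. lg_height (a j c))"
    "\<And>p j c. prime p \<Longrightarrow> \<not> p dvd D \<Longrightarrow> j < L \<Longrightarrow> a j c \<noteq> 0 \<Longrightarrow> \<not> p dvd height (a j c)"
    "\<And>p j k l \<alpha> \<beta> y. \<lbrakk>prime p; \<not> p dvd D; l < L; j < l; k < l;
      \<forall>c. a l c = \<alpha> * a j c + \<beta> * a k c;
      \<forall>i<l. (\<Sum>c | a i c \<noteq> 0. a i c * y c) \<in> p_ideal p\<rbrakk>
      \<Longrightarrow> (\<Sum>c | a l c \<noteq> 0. a l c * y c) \<in> p_ideal p"
proof -
  define M where "M j = {c. a j c \<noteq> 0}" for j
  define I where "I = {j. j < L \<and> M j \<noteq> {}}"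
  have fI: "finite I" by (simp add: I_def)
  have fM: "finite (M j)" if "j \<in> I" for j using fin that by (simp add: I_def M_def)
  have nz: "a j c \<noteq> 0" if "c \<in> M j" for j c using that by (simp add: M_def)
  define S where "S = (\<Sum>j\<in>I. \<Sum>c\<in>M j. lg_height (a j c))"
  have S: "S = (\<Sum>j<L. \<Sum>c | a j c \<noteq> 0. lg_height (a j c))"
    unfolding S_def M_def[symmetric] by (rule sum.mono_neutral_left) (auto simp: I_def)
  define cheap where "cheap X c \<longleftrightarrow> c \<in> X \<and>
      real (card X) * (\<Sum>j | j \<in> I \<and> M j = X. lg_height (a j c)) \<le>
        (\<Sum>j | j \<in> I \<and> M j = X. \<Sum>c\<in>X. lg_height (a j c))" for X c
  have "\<exists>c. cheap X c" if "finite X" "X \<noteq> {}" for X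
    using ex_cheap_index[OF that, of "\<lambda>j c. lg_height (a j c)" "{j. j \<in> I \<and> M j = X}"]
    unfolding cheap_def by blast
  hence cheap_piv: "cheap X (SOME c. cheap X c)" if "finite X" "X \<noteq> {}" for X
    using that by (blast intro: someI_ex)
  \<comment> \<open>The pivot depends on the set of monomials alone, so lines with equal support are
    normalized at the same monomial.\<close>
  define piv where "piv X = (SOME c. cheap X c)" for X
  have piv: "piv X \<in> X \<and>
      real (card X) * (\<Sum>j | j \<in> I \<and> M j = X. lg_height (a j (piv X))) \<le>
        (\<Sum>j | j \<in> I \<and> M j = X. \<Sum>c\<in>X. lg_height (a j c))" if "finite X" "X \<noteq> {}" for X
    using cheap_piv[OF that] unfolding piv_def[symmetric] unfolding cheap_def .
  define c0 where "c0 j = piv (M j)" for j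
  have c0: "c0 j \<in> M j" if "j \<in> I" for j
    using piv[OF fM[OF that]] that by (simp add: c0_def I_def)
  \<comment> \<open>This bounds the bits of the normalized coefficients of line \<open>j\<close>. By
    the choice of the pivots, their share adds up to at most \<open>S\<close>.\<close>
  define \<tau> where "\<tau> j = (\<Sum>c\<in>M j. lg_height (a j c) + lg_height (a j (c0 j)))" for j
  have \<tau>_sum: "(\<Sum>j\<in>I. \<tau> j) \<le> 2 * S"
  proof -
    have "(\<Sum>j\<in>I. real (card (M j)) * lg_height (a j (c0 j))) =
        (\<Sum>X\<in>M ` I. \<Sum>j | j \<in> I \<and> M j = X. real (card (M j)) * lg_height (a j (c0 j)))"
      by (rule sum.image_gen[OF fI])
    also have "\<dots> = (\<Sum>X\<in>M ` I. real (card X) * (\<Sum>j | j \<in> I \<and> M j = X. lg_height (a j (piv X))))"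
      unfolding sum_distrib_left by (intro sum.cong refl) (auto simp: c0_def)
    also have "\<dots> \<le> (\<Sum>X\<in>M ` I. \<Sum>j | j \<in> I \<and> M j = X. \<Sum>c\<in>X. lg_height (a j c))"
      using piv fM by (intro sum_mono) (auto simp: I_def)
    also have "\<dots> = (\<Sum>X\<in>M ` I. \<Sum>j | j \<in> I \<and> M j = X. \<Sum>c\<in>M j. lg_height (a j c))"
      by (intro sum.cong refl) auto
    also have "\<dots> = S" unfolding S_def by (rule sum.image_gen[OF fI, symmetric])
    finally show ?thesis
      by (simp add: \<tau>_def sum.distrib S_def)
  qed
  \<comment> \<open>A group consists of lines with the same monomials, the same positions where the
    normalized coefficient is 1 or -1, and the same signs there. The value 0 elsewhere makes
    \<open>W\<close> comparable as a function.\<close>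
  define N where "N j = {c \<in> M j. \<bar>a j c\<bar> \<noteq> \<bar>a j (c0 j)\<bar>}" for j
  define W where "W j = (\<lambda>c. if c \<in> M j - N j then a j c / a j (c0 j) else 0)" for j
  define key where "key j = (M j, N j, W j)" for j
  define K where "K g = {j \<in> I. key j = g}" for g
  have "\<exists>z::int. z \<noteq> 0 \<and> log 2 \<bar>z\<bar> \<le> 2 * (\<Sum>j\<in>K g. \<tau> j) \<and>
      (\<forall>p. prime p \<longrightarrow> \<not> p dvd z \<longrightarrow> (\<forall>i\<in>K g. \<not> p dvd height (a i (c0 i))) \<longrightarrow>
        combination_closed p (K g) (fst g) a)" if g: "g \<in> key ` I" for g
  proof -
    obtain X Y w where XYw: "g = (X, Y, w)" by (cases g)
    have KI: "j \<in> I" and KX: "M j = X" and KY: "N j = Y" and Kw: "W j = w" and Kc0: "c0 j = piv X"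
      if "j \<in> K g" for j
      using that by (auto simp: K_def key_def XYw c0_def)
    obtain j0 where "j0 \<in> K g" using g by (auto simp: K_def)
    hence X: "finite X" "piv X \<in> X" using KI KX Kc0 fM c0 by metis+
    have fK: "finite (K g)" using fI by (simp add: K_def)
    have nzK: "a j c \<noteq> 0" if "j \<in> K g" "c \<in> X" for j c
      using nz[of c j] KX that by simp
    have NK: "Y = {c \<in> X. \<bar>a j c\<bar> \<noteq> \<bar>a j (piv X)\<bar>}" if "j \<in> K g" for j
      using KX[OF that] KY[OF that] Kc0[OF that] unfolding N_def by simp
    have wK: "a j c = w c * a j (piv X)" if "j \<in> K g" "c \<in> X - Y" for j c
      using KX[OF that(1)] KY[OF that(1)] Kw[OF that(1)] Kc0[OF that(1)] that(2) nzK[OF that(1) X(2)]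
      unfolding W_def by auto
    obtain z :: int where z: "z \<noteq> 0"
      "log 2 \<bar>z\<bar> \<le> 2 * (\<Sum>j\<in>K g. \<Sum>c\<in>X. lg_height (a j c) + lg_height (a j (piv X)))"
      "\<And>p. \<lbrakk>prime p; \<not> p dvd z; \<forall>i\<in>K g. \<not> p dvd height (a i (piv X))\<rbrakk>
        \<Longrightarrow> combination_closed p (K g) X a"
      by (rule ex_controlling_integer_group[of "K g" X "piv X" a Y w, OF fK X nzK NK wK])
        (assumption+, rule that)
    have "(\<Sum>j\<in>K g. \<tau> j) = (\<Sum>j\<in>K g. \<Sum>c\<in>X. lg_height (a j c) + lg_height (a j (piv X)))"
      using KX Kc0 by (intro sum.cong refl) (simp add: \<tau>_def)
    thus ?thesis using z Kc0 by (auto simp: XYw)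
  qed
  then obtain z :: "_ \<Rightarrow> int" where z: "\<And>g. g \<in> key ` I \<Longrightarrow> z g \<noteq> 0"
      "\<And>g. g \<in> key ` I \<Longrightarrow> log 2 \<bar>z g\<bar> \<le> 2 * (\<Sum>j\<in>K g. \<tau> j)"
      "\<And>g p. g \<in> key ` I \<Longrightarrow> prime p \<Longrightarrow> \<not> p dvd z g \<Longrightarrow>
        (\<forall>i\<in>K g. \<not> p dvd height (a i (c0 i))) \<Longrightarrow> combination_closed p (K g) (fst g) a"
    by metis
  define E where "E j = (\<Prod>c\<in>M j. height (a j c))" for j
  define C where "C j = (\<Prod>c\<in>N j. square_gap (a j c) (a j (c0 j)))" for j
  \<comment> \<open>\<open>E\<close> covers the primes at which a coefficient is not a unit,
    \<open>C\<close> those modulo which a normalized coefficient becomes 1 or -1 without being so,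
    and \<open>z\<close> those at which a group is not controlled.\<close>
  define D where "D = 2 * (\<Prod>j\<in>I. E j) * (\<Prod>j\<in>I. C j) * (\<Prod>g\<in>key ` I. z g)"
  have H: "0 < height (a j c)" if "c \<in> M j" for j c using height_ge_1[OF nz[OF that]] by simp
  have E: "0 < E j" for j unfolding E_def using H by (intro prod_pos) auto
  have NM: "N j \<subseteq> M j" for j by (auto simp: N_def)
  have fN: "finite (N j)" if "j \<in> I" for j by (rule finite_subset[OF NM fM[OF that]])
  have gap: "square_gap (a j c) (a j (c0 j)) \<noteq> 0" if "j \<in> I" "c \<in> N j" for j c
    using that square_gap_nonzero[OF nz nz[OF c0]] by (auto simp: N_def)
  have C: "C j \<noteq> 0" if "j \<in> I" for j
    using gap[OF that] fN[OF that] by (simp add: C_def)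
  have logE: "log 2 (E j) = (\<Sum>c\<in>M j. lg_height (a j c))" for j
    unfolding E_def using H by (rule log_prod_of_int)
  have logC: "log 2 \<bar>C j\<bar> \<le> 2 * \<tau> j" if j: "j \<in> I" for j
  proof -
    have Hc0: "0 < height (a j (c0 j))" using H[OF c0[OF j]] .
    have "log 2 \<bar>C j\<bar> = (\<Sum>c\<in>N j. log 2 \<bar>square_gap (a j c) (a j (c0 j))\<bar>)"
      using log_prod_of_int[of "N j" "\<lambda>c. \<bar>square_gap (a j c) (a j (c0 j))\<bar>" 2] gap[OF j]
      by (simp add: C_def abs_prod)
    also have "\<dots> \<le> (\<Sum>c\<in>N j. 2 * (lg_height (a j c) + lg_height (a j (c0 j))))"
    proof (intro sum_mono)
      fix c assume c: "c \<in> N j"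
      hence cM: "c \<in> M j" using NM by blast
      have "real_of_int \<bar>square_gap (a j c) (a j (c0 j))\<bar> \<le>
          real_of_int ((height (a j c) * height (a j (c0 j)))\<^sup>2)"
        using abs_square_gap_le[OF nz[OF cM] nz[OF c0[OF j]]] by (simp only: of_int_le_iff)
      hence "log 2 \<bar>square_gap (a j c) (a j (c0 j))\<bar> \<le>
          log 2 (real_of_int ((height (a j c) * height (a j (c0 j)))\<^sup>2))"
        using gap[OF j c] by (intro log_mono) auto
      thus "log 2 \<bar>square_gap (a j c) (a j (c0 j))\<bar> \<le> 2 * (lg_height (a j c) + lg_height (a j (c0 j)))"
        using H[OF cM] Hc0 by (simp add: log_nat_power log_mult)
    qed
    also have "\<dots> \<le> (\<Sum>c\<in>M j. 2 * (lg_height (a j c) + lg_height (a j (c0 j))))"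
      using NM fM[OF j] by (intro sum_mono2) (auto intro!: add_nonneg_nonneg lg_height_nonneg)
    finally show ?thesis by (simp add: \<tau>_def sum_distrib_left)
  qed
  have height_dvd: "height (a j c) dvd D" if "j < L" "a j c \<noteq> 0" for j c
  proof -
    have "c \<in> M j" "j \<in> I" using that by (auto simp: M_def I_def)
    hence "height (a j c) dvd E j" "E j dvd (\<Prod>j\<in>I. E j)"
      unfolding E_def using fM fI by (auto intro: dvd_prodI)
    thus ?thesis unfolding D_def by (meson dvd_mult dvd_mult2 dvd_trans)
  qed
  show thesis
  proof (rule that)
    have pos: "0 < (\<Prod>j\<in>I. E j)" "0 < (\<Prod>j\<in>I. \<bar>C j\<bar>)" "0 < (\<Prod>g\<in>key ` I. \<bar>z g\<bar>)"
      by (intro prod_pos, use E C z(1) in simp)+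
    have "\<bar>D\<bar> = 2 * (\<Prod>j\<in>I. E j) * (\<Prod>j\<in>I. \<bar>C j\<bar>) * (\<Prod>g\<in>key ` I. \<bar>z g\<bar>)"
      by (simp add: D_def abs_mult abs_prod abs_of_pos[OF E])
    hence "0 < \<bar>D\<bar>" using pos by simp
    thus "D \<noteq> 0" by simp
    have "log 2 \<bar>D\<bar> = 1 + log 2 (\<Prod>j\<in>I. E j) + log 2 (\<Prod>j\<in>I. \<bar>C j\<bar>) + log 2 (\<Prod>g\<in>key ` I. \<bar>z g\<bar>)"
      using pos \<open>\<bar>D\<bar> = _\<close> by (simp add: log_mult del: of_int_prod)
    also have "\<dots> = 1 + (\<Sum>j\<in>I. log 2 (E j)) + (\<Sum>j\<in>I. log 2 \<bar>C j\<bar>) + (\<Sum>g\<in>key ` I. log 2 \<bar>z g\<bar>)"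
      using E C z(1) by (subst (1 2 3) log_prod_of_int) auto
    \<comment> \<open>Each of the last two sums is twice the sum of \<tau>, hence at most
      \<open>4 * S\<close>; the constant is 9 = 1 + 4 + 4.\<close>
    also have "\<dots> \<le> 1 + S + (\<Sum>j\<in>I. 2 * \<tau> j) + (\<Sum>g\<in>key ` I. 2 * (\<Sum>j\<in>K g. \<tau> j))"
      unfolding S_def using z(2) logC by (intro add_mono sum_mono) (auto simp: logE)
    also have "(\<Sum>g\<in>key ` I. 2 * (\<Sum>j\<in>K g. \<tau> j)) = 2 * (\<Sum>j\<in>I. \<tau> j)"
      unfolding K_def sum_distrib_left[symmetric] using sum.image_gen[OF fI, of \<tau> key] by simp
    also have "(\<Sum>j\<in>I. 2 * \<tau> j) = 2 * (\<Sum>j\<in>I. \<tau> j)" by (simp add: sum_distrib_left)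
    finally show "log 2 \<bar>D\<bar> \<le> 1 + 9 * (\<Sum>j<L. \<Sum>c | a j c \<noteq> 0. lg_height (a j c))"
      using \<tau>_sum S by linarith
  next
    fix p :: int and j :: nat and c
    assume "\<not> p dvd D" "j < L" "a j c \<noteq> 0"
    thus "\<not> p dvd height (a j c)" using height_dvd dvd_trans by blast
  next
    fix p :: int and j k l :: nat and \<alpha> \<beta> :: rat and y :: "'c \<Rightarrow> rat"
    assume p: "prime p" and ndvd: "\<not> p dvd D" and l: "l < L" "j < l" "k < l"
      and comb: "\<forall>c. a l c = \<alpha> * a j c + \<beta> * a k c"
      and prev: "\<forall>i<l. (\<Sum>c | a i c \<noteq> 0. a i c * y c) \<in> p_ideal p"
    note T = comb[rule_format] and y = prev[rule_format]
    have hdvd: "\<not> p dvd height (a i c)" if "i < L" "a i c \<noteq> 0" for i c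
      using height_dvd[OF that] ndvd dvd_trans by blast
    have unit: "a i c \<in> p_integral p \<and> a i c \<notin> p_ideal p" if "i < L" "a i c \<noteq> 0" for i c
      using not_dvd_height_unit[OF p hdvd[OF that]] by blast
    have int: "a i c \<in> p_integral p" if "i < L" for i c
      using unit[OF that] p_integral_0[OF p] by (cases "a i c = 0") auto
    have jkL: "j < L" "k < L" using l by auto
    have ext: "(\<Sum>c | a i c \<noteq> 0. a i c * y c) = (\<Sum>c\<in>B. a i c * y c)"
      if "finite B" "M i \<subseteq> B" for i B
      using that by (intro sum.mono_neutral_left) (auto simp: M_def)
    show "(\<Sum>c | a l c \<noteq> 0. a l c * y c) \<in> p_ideal p"
    proof (rule p_integral_combination_cases[OF p T int[OF l(1)] unit[OF jkL(1)] unit[OF jkL(2)]])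
      fix \<alpha>' \<beta>' assume \<alpha>\<beta>: "\<alpha>' \<in> p_integral p" "\<beta>' \<in> p_integral p"
        and T': "\<And>c. a l c = \<alpha>' * a j c + \<beta>' * a k c"
      define B where "B = M j \<union> M k"
      have B: "finite B" "M j \<subseteq> B" "M k \<subseteq> B" "M l \<subseteq> B"
        using fin[OF jkL(1)] fin[OF jkL(2)] by (auto simp: B_def M_def T)
      have "(\<Sum>c | a l c \<noteq> 0. a l c * y c) =
          (\<Sum>c | a j c \<noteq> 0. a j c * y c) * \<alpha>' + (\<Sum>c | a k c \<noteq> 0. a k c * y c) * \<beta>'"
        unfolding ext[OF B(1,2)] ext[OF B(1,3)] ext[OF B(1,4)]
        by (simp add: T' sum_distrib_left sum.distrib algebra_simps)
      thus ?thesis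
        using y[OF l(2)] y[OF l(3)] \<alpha>\<beta> p by (simp add: p_ideal_add p_ideal_mult)
    next
      assume supp: "\<And>c. a j c \<noteq> 0 \<longleftrightarrow> a k c \<noteq> 0" and "\<exists>c. a j c \<noteq> 0"
        and minors: "\<And>c d. a j c * a k d - a j d * a k c \<in> p_ideal p"
      have Meq: "M j = M k" unfolding M_def using supp by auto
      have jkI: "j \<in> I" "k \<in> I" using \<open>\<exists>c. a j c \<noteq> 0\<close> jkL supp by (auto simp: I_def M_def)
      define d where "d = c0 j"
      have d: "c0 j = d" "c0 k = d" "d \<in> M j" "d \<in> M k" 
        using c0[OF jkI(1)] Meq by (simp_all add: d_def c0_def)
      have gap_ndvd: "\<not> p dvd square_gap (a i c) (a i (c0 i))" if "i \<in> I" "c \<in> N i" for i c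
      proof -
        have "square_gap (a i c) (a i (c0 i)) dvd C i"
          unfolding C_def using that(2) fN[OF that(1)] by (intro dvd_prodI)
        moreover have "C i dvd (\<Prod>j\<in>I. C j)" using that fI by (intro dvd_prodI) auto
        ultimately have "square_gap (a i c) (a i (c0 i)) dvd D"
          unfolding D_def by (meson dvd_mult dvd_mult2 dvd_trans)
        thus ?thesis using ndvd dvd_trans by blast
      qed
      \<comment> \<open>If line \<open>i\<close> has 1 or -1 at \<open>c\<close> after
        normalization, proportionality modulo \<open>p\<close> makes the square of the normalized
        coefficient of line \<open>i'\<close> equal to 1 modulo \<open>p\<close>. Unless it equals 1
        exactly, \<open>p\<close> divides the corresponding square gap, a factor of
        \<open>D\<close>.\<close>
      have N_sub: "N i' \<subseteq> N i" if i: "i \<in> I" "i' \<in> I" "M i = M i'" "c0 i = d" "c0 i' = d"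
        and min: "\<And>c. a i c * a i' d - a i d * a i' c \<in> p_ideal p" for i i'
      proof
        fix c assume c: "c \<in> N i'"
        hence cM: "c \<in> M i'" "c \<in> M i" using NM i by auto
        have dM: "d \<in> M i" "d \<in> M i'" using c0 i by metis+
        have L: "i < L" "i' < L" using i by (auto simp: I_def)
        show "c \<in> N i"
        proof (rule ccontr)
          assume "c \<notin> N i"
          hence "\<bar>a i c\<bar> = \<bar>a i d\<bar>" using cM i by (simp add: N_def)
          then obtain s where s: "s \<in> {1, -1}" "a i c = s * a i d" using sign_cases by blast
          have s_int: "s \<in> p_integral p" using s p p_integral_1 p_integral_minus by blast
          have "a i d * (s * a i' d - a i' c) \<in> p_ideal p"
            using min[of c] by (simp add: s(2) algebra_simps)
          hence "s * a i' d - a i' c \<in> p_ideal p"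
            using p_ideal_prime_ideal[OF p, of "a i d" "s * a i' d - a i' c"]
              unit[OF L(1) nz[OF dM(1)]] p_integral_diff[OF p p_integral_mult[OF p s_int int[OF L(2)]] int[OF L(2)]]
            by blast
          hence "(s * a i' d - a i' c) * (- s * a i' d - a i' c) \<in> p_ideal p"
            using p s_int int[OF L(2)]
            by (intro p_ideal_mult[of p "_ - _"] p_integral_diff p_integral_mult p_integral_minus)
          also have "(s * a i' d - a i' c) * (- s * a i' d - a i' c) = a i' c * a i' c - a i' d * a i' d"
            using s(1) by (auto simp: algebra_simps)
          finally have "p dvd square_gap (a i' c) (a i' d)"
            by (rule square_gap_dvd[OF p nz[OF dM(2)] hdvd[OF L(2) nz[OF cM(1)]] hdvd[OF L(2) nz[OF dM(2)]]])
          thus False using gap_ndvd[OF i(2) c] i(5) by simp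
        qed
      qed
      have minors': "a k c * a j d - a k d * a j c \<in> p_ideal p" for c
        using p_ideal_minus[OF p minors[of c d]] minors[of d c] by (simp add: mult.commute)
      have Neq: "N j = N k"
        using N_sub[OF jkI Meq d(1,2) minors] N_sub[OF jkI(2,1) Meq[symmetric] d(2,1) minors'] by blast
      \<comment> \<open>Proportionality makes the two signs congruent modulo \<open>p\<close>, and
        \<open>p\<close> is odd because 2 divides \<open>D\<close>.\<close>
      have "W j c = W k c" for c
      proof (cases "c \<in> M j - N j")
        case True
        have aj: "a j d \<noteq> 0" and ak: "a k d \<noteq> 0" using nz d(3,4) by auto
        have "\<bar>a j c\<bar> = \<bar>a j d\<bar>" "\<bar>a k c\<bar> = \<bar>a k d\<bar>" using True Meq Neq d by (auto simp: N_def)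
        then obtain s t where st: "s \<in> {1, -1}" "a j c = s * a j d" "t \<in> {1, -1}" "a k c = t * a k d"
          using sign_cases by metis
        have "(a j d * a k d) * (s - t) \<in> p_ideal p"
          using minors[of c d] by (simp add: st algebra_simps)
        moreover have "s - t \<in> p_integral p"
          using st p p_integral_1 p_integral_minus p_integral_diff by (metis empty_iff insert_iff)
        moreover have "a j d * a k d \<notin> p_ideal p" "a j d * a k d \<in> p_integral p"
          using p_ideal_prime_ideal[OF p int[OF jkL(1)] int[OF jkL(2)]] unit[OF jkL(1) aj] unit[OF jkL(2) ak]
            p_integral_mult[OF p] by blast+
        ultimately have "s - t \<in> p_ideal p" using p_ideal_prime_ideal[OF p] by blast
        moreover have "\<not> p dvd 2" using ndvd unfolding D_def by (meson dvd_mult2)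
        hence "of_int 2 \<notin> p_ideal p" using of_int_in_p_ideal_iff[OF p] by blast
        moreover from this have "- of_int 2 \<notin> p_ideal p" using p_ideal_minus[OF p, of "- of_int 2"] by auto
        ultimately have "s = t" using st(1,3) by auto
        thus ?thesis using True Meq Neq d aj ak by (simp add: W_def st)
      next
        case False
        thus ?thesis unfolding W_def Meq Neq by (simp only: if_False)
      qed
      hence "key j = key k" using Meq Neq by (auto simp: key_def)
      define g where "g = key j"
      have g: "g \<in> key ` I" "j \<in> K g" "k \<in> K g"
        using jkI \<open>key j = key k\<close> by (auto simp: g_def K_def)
      have "z g dvd (\<Prod>g\<in>key ` I. z g)" using g fI by (intro dvd_prodI) auto
      hence "\<not> p dvd z g" using ndvd unfolding D_def by (meson dvd_mult dvd_trans)
      moreover have "\<forall>i\<in>K g. \<not> p dvd height (a i (c0 i))"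
        using hdvd nz c0 by (auto simp: K_def I_def)
      ultimately have "combination_closed p (K g) (fst g) a" using z(3)[OF g(1) p] by blast
      moreover have "fst g = M j" by (simp add: g_def key_def)
      ultimately have cc: "combination_closed p (K g) (M j) a" by simp
      have Kj: "M i = M j" if "i \<in> K g" for i using that by (simp add: K_def g_def key_def)
      have "(\<Sum>c\<in>M j. (\<alpha> * a j c + \<beta> * a k c) * y c) \<in> p_ideal p"
      proof (rule cc[unfolded combination_closed_def, rule_format, OF g(2,3) l(2,3)])
        show "\<alpha> * a j c + \<beta> * a k c \<in> p_integral p" for c
          using int[OF l(1), of c] T by simp
        show "(\<Sum>c\<in>M j. a i c * y c) \<in> p_ideal p" if "i \<in> K g" "i < l" for i
          using y[OF that(2)] Kj[OF that(1)] by (simp add: M_def)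
      qed
      moreover have "(\<Sum>c | a l c \<noteq> 0. a l c * y c) = (\<Sum>c\<in>M j. a l c * y c)"
        using fM[OF jkI(1)] supp by (intro ext) (auto simp: M_def T)
      ultimately show ?thesis by (simp add: T)
    qed
  qed
qed

section \<open>Refutations\<close>

lemma lg_height_le_rat_size:
  assumes "q \<noteq> 0"
  shows "lg_height q \<le> real_of_int (rat_size q)"
proof -
  obtain a b where ab: "quotient_of q = (a, b)" by (cases "quotient_of q")
  have b: "b > 0" using ab quotient_of_denom_pos by blast
  have "q = of_int a / of_int b" using ab quotient_of_div by blast
  hence "a \<noteq> 0" using assms by auto
  hence "lg_height q = log 2 \<bar>real_of_int a\<bar> + log 2 \<bar>real_of_int b\<bar>"
    using b by (simp add: height_def ab log_mult)
  also have "\<dots> \<le> real_of_int (rat_size q)"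
    by (simp add: rat_size_def ab add_mono)
  finally show ?thesis .
qed

lemma lookup_eq_0_iff: "{c. Poly_Mapping.lookup P c \<noteq> 0} = Poly_Mapping.keys P"
  by (auto simp: in_keys_iff)

lemma sum_lg_height_le_refutation_size:
  "(\<Sum>j<length Rs. \<Sum>c | Poly_Mapping.lookup (Rs ! j) c \<noteq> 0. lg_height (Poly_Mapping.lookup (Rs ! j) c))
    \<le> real_of_int (refutation_size Rs)"
proof -
  have "refutation_size Rs = (\<Sum>j<length Rs. poly_size (Rs ! j))"
    by (simp add: refutation_size_def sum_list_sum_nth atLeast0LessThan)
  thus ?thesis
    unfolding lookup_eq_0_iff
    by (simp add: poly_size_def) (intro sum_mono lg_height_le_rat_size, simp add: in_keys_iff)
qed

section \<open>Points at which the axioms vanish modulo a prime\<close>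

lemma sum_binary_digits:
  fixes b :: nat
  shows "(\<Sum>i=1..n. 2 ^ (i - 1) * (b div 2 ^ (i - 1) mod 2)) = b mod 2 ^ n"
proof (induction n)
  case (Suc n)
  have "b mod 2 ^ Suc n = 2 ^ n * (b div 2 ^ n mod 2) + b mod 2 ^ n"
    using mod_mult2_eq[of b "2 ^ n" 2] by (simp add: mult.commute)
  thus ?case using Suc by simp
qed simp

lemma mpoly_eval_p_integral:
  assumes "prime p" "\<And>m. Poly_Mapping.lookup P m \<in> p_integral p" "\<And>v. \<rho> v \<in> p_integral p"
  shows "mpoly_eval \<rho> P \<in> p_integral p"
  unfolding mpoly_eval_def monom_eval_def using assms
  by (intro p_integral_sum p_integral_mult p_integral_prod p_integral_power)

text \<open>Course-of-values recursion: masking all values from index \<open>i\<close> on by 0 makes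
  every recursive call go to a smaller index.\<close>

fun ext_val :: "(nat \<Rightarrow> (nat \<Rightarrow> 'a::zero) \<Rightarrow> 'a) \<Rightarrow> nat \<Rightarrow> 'a" where
  "ext_val F i = F i (\<lambda>j. if j < i then ext_val F j else 0)"

declare ext_val.simps [simp del]

text \<open>Definitions with a coefficient that is not \<open>p\<close>-integral are not used in the
  refutation, so that the corresponding extension variables may take the value 0.\<close>

lemma ex_p_integral_assignment:
  fixes Q :: "nat \<Rightarrow> (var, rat) mpoly"
  assumes p: "prime p" and \<xi>: "\<And>i. \<xi> i \<in> p_integral p"
    and vars: "\<And>i. i \<in> {1..m} \<Longrightarrow> vars (Q i) \<subseteq> XVar ` {1..n} \<union> YVar ` {1..<i}"
  obtains \<rho> where "\<And>v. \<rho> v \<in> p_integral p" "\<And>i. \<rho> (XVar i) = \<xi> i"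
    "\<And>i. i \<in> {1..m} \<Longrightarrow> \<forall>c. Poly_Mapping.lookup (Q i) c \<in> p_integral p \<Longrightarrow>
      \<rho> (YVar i) = mpoly_eval \<rho> (Q i)"
proof -
  define \<rho> where "\<rho> \<eta> v = (case v of XVar i \<Rightarrow> \<xi> i | YVar i \<Rightarrow> \<eta> i)" for \<eta> :: "nat \<Rightarrow> rat" and v
  define F where "F i \<eta> = (if \<forall>c. Poly_Mapping.lookup (Q i) c \<in> p_integral p
    then mpoly_eval (\<rho> \<eta>) (Q i) else 0)" for i \<eta>
  define \<eta> where "\<eta> = ext_val F"
  have \<eta>: "\<eta> i = F i (\<lambda>j. if j < i then \<eta> j else 0)" for i
    unfolding \<eta>_def by (rule ext_val.simps)
  have \<rho>_int: "\<rho> \<zeta> v \<in> p_integral p" if "\<And>i. \<zeta> i \<in> p_integral p" for \<zeta> v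
    using that \<xi> by (cases v) (simp_all add: \<rho>_def)
  have \<eta>_int: "\<eta> i \<in> p_integral p" for i
  proof (induction i rule: less_induct)
    case (less i)
    show ?case
      unfolding \<eta>[of i] F_def
      using p less p_integral_0[OF p] by (auto intro!: mpoly_eval_p_integral \<rho>_int)
  qed
  show thesis
  proof (rule that[of "\<rho> \<eta>"])
    show "\<rho> \<eta> v \<in> p_integral p" for v using \<rho>_int \<eta>_int by blast
    show "\<rho> \<eta> (XVar i) = \<xi> i" for i by (simp add: \<rho>_def)
    fix i assume i: "i \<in> {1..m}" and int: "\<forall>c. Poly_Mapping.lookup (Q i) c \<in> p_integral p"
    have "\<rho> \<eta> (YVar i) = \<eta> i" by (simp add: \<rho>_def)
    also have "\<dots> = mpoly_eval (\<rho> (\<lambda>j. if j < i then \<eta> j else 0)) (Q i)"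
      unfolding \<eta>[of i] F_def using int by simp
    \<comment> \<open>\<open>Q i\<close> contains only extension variables of index below
      \<open>i\<close>, so the mask is invisible to it.\<close>
    also have "\<dots> = mpoly_eval (\<rho> \<eta>) (Q i)"
      using vars[OF i] by (intro mpoly_eval_cong) (auto simp: \<rho>_def)
    finally show "\<rho> \<eta> (YVar i) = mpoly_eval (\<rho> \<eta>) (Q i)" .
  qed
qed

text \<open>For a prime up to \<open>2 ^ n\<close> not dividing \<open>D\<close>, all lines vanish
  modulo it at the chosen point, by induction along the refutation. The last line is a nonzero
  constant that is a unit there, a contradiction.\<close>

lemma log_refutation_bound:
  fixes Rs :: "(var, rat) mpoly list"
  assumes ref: "ext_pc_sqrt_refutation n (BVP n) Rs"
  obtains D :: nat where "D \<noteq> 0" "log 2 D \<le> 1 + 9 * real_of_int (refutation_size Rs)"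
    "\<And>p. prime p \<Longrightarrow> p \<le> 2 ^ n \<Longrightarrow> p dvd D"
proof -
  let ?a = "\<lambda>j. Poly_Mapping.lookup (Rs ! j)"
  let ?L = "length Rs"
  obtain D :: int where D0: "D \<noteq> 0"
    and D_log: "log 2 \<bar>D\<bar> \<le> 1 + 9 * (\<Sum>j<?L. \<Sum>c | ?a j c \<noteq> 0. lg_height (?a j c))"
    and D_unit: "\<And>p j c. prime p \<Longrightarrow> \<not> p dvd D \<Longrightarrow> j < ?L \<Longrightarrow> ?a j c \<noteq> 0 \<Longrightarrow> \<not> p dvd height (?a j c)"
    and D_comb: "\<And>p j k l \<alpha> \<beta> y. \<lbrakk>prime p; \<not> p dvd D; l < ?L; j < l; k < l;
      \<forall>c. ?a l c = \<alpha> * ?a j c + \<beta> * ?a k c;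
      \<forall>i<l. (\<Sum>c | ?a i c \<noteq> 0. ?a i c * y c) \<in> p_ideal p\<rbrakk>
      \<Longrightarrow> (\<Sum>c | ?a l c \<noteq> 0. ?a l c * y c) \<in> p_ideal p"
    by (rule ex_controlling_integer[of ?L ?a]) (simp, rule that)
  obtain m Q where vars: "\<And>i. i \<in> {1..m} \<Longrightarrow> vars (Q i) \<subseteq> XVar ` {1..n} \<union> YVar ` {1..<i}"
    and pc: "pc_sqrt_refutation (XVar ` {1..n} \<union> YVar ` {1..m})
      (BVP n \<union> (\<lambda>i. var_poly (YVar i) - Q i) ` {1..m}) Rs"
    using ref unfolding ext_pc_sqrt_refutation_def by blast
  show thesis
  proof (rule that)
    show "nat \<bar>D\<bar> \<noteq> 0" using D0 by simp
    show "log 2 (nat \<bar>D\<bar>) \<le> 1 + 9 * real_of_int (refutation_size Rs)"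
      using D_log sum_lg_height_le_refutation_size[of Rs] by simp
    fix q :: nat assume q: "prime q" "q \<le> 2 ^ n"
    define p where "p = int q"
    have p: "prime p" using q by (simp add: p_def)
    have "p dvd D"
    proof (rule ccontr)
      assume ndvd: "\<not> p dvd D"
      \<comment> \<open>Variable \<open>i\<close> receives the digit of weight
        \<open>2 ^ (i - 1)\<close>, so the linear axiom takes the value \<open>q\<close>.\<close>
      define \<xi> where "\<xi> i = rat_of_nat ((q - 1) div 2 ^ (i - 1) mod 2)" for i
      have \<xi>: "\<xi> i \<in> p_integral p" for i
        unfolding \<xi>_def by (rule p_integral_of_nat[OF p])
      obtain \<rho> where \<rho>: "\<And>v. \<rho> v \<in> p_integral p" "\<And>i. \<rho> (XVar i) = \<xi> i"
        "\<And>i. i \<in> {1..m} \<Longrightarrow> \<forall>c. Poly_Mapping.lookup (Q i) c \<in> p_integral p \<Longrightarrow>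
          \<rho> (YVar i) = mpoly_eval \<rho> (Q i)"
        by (rule ex_p_integral_assignment[of p \<xi> m Q n, OF p \<xi> vars]) (assumption, rule that)
      let ?e = "mpoly_eval \<rho>"
      have e: "?e (Rs ! j) = (\<Sum>c | ?a j c \<noteq> 0. ?a j c * monom_eval \<rho> c)" for j
        by (simp add: mpoly_eval_def lookup_eq_0_iff)
      have a_int: "?a j c \<in> p_integral p" if "j < ?L" for j c
        using not_dvd_height_unit[OF p D_unit[OF p ndvd that]] p_integral_0[OF p]
        by (cases "?a j c = 0") auto
      have "?e (Rs ! l) \<in> p_ideal p" if "l < ?L" for l
        using that
      proof (induction l rule: less_induct)
        case (less l)
        have step: "Rs ! l \<in> BVP n \<union> (\<lambda>i. var_poly (YVar i) - Q i) ` {1..m} \<or>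
            (\<exists>j<l. \<exists>k<l. \<exists>\<alpha> \<beta>. Rs ! l = const_poly \<alpha> * Rs ! j + const_poly \<beta> * Rs ! k) \<or>
            (\<exists>k<l. \<exists>v\<in>XVar ` {1..n} \<union> YVar ` {1..m}. Rs ! l = var_poly v * Rs ! k) \<or>
            (\<exists>k<l. (Rs ! l)\<^sup>2 = Rs ! k)"
          using pc less.prems by (simp only: pc_sqrt_refutation_def)
        have IH: "?e (Rs ! i) \<in> p_ideal p" if "i < l" for i using less that by auto
        consider (first) "Rs ! l = (\<Sum>i=1..n. const_poly (2 ^ (i - 1)) * var_poly (XVar i)) + 1"
          | (boolean) i where "Rs ! l = (var_poly (XVar i))\<^sup>2 - var_poly (XVar i)"
          | (extension) i where "i \<in> {1..m}" "Rs ! l = var_poly (YVar i) - Q i"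
          | (comb) j k \<alpha> \<beta> where "j < l" "k < l"
              "Rs ! l = const_poly \<alpha> * Rs ! j + const_poly \<beta> * Rs ! k"
          | (mult) k v where "k < l" "Rs ! l = var_poly v * Rs ! k"
          | (sqrt) k where "k < l" "(Rs ! l)\<^sup>2 = Rs ! k"
          using step unfolding BVP_def by (elim disjE UnE insertE imageE exE conjE bexE) blast+
        thus ?case
        proof cases
          case first
          have "?e (Rs ! l) = (\<Sum>i=1..n. 2 ^ (i - 1) * \<xi> i) + 1"
            by (simp add: first mpoly_eval_add mpoly_eval_sum mpoly_eval_mult \<rho>)
          also have "(\<Sum>i=1..n. 2 ^ (i - 1) * \<xi> i) =
              of_nat (\<Sum>i=1..n. 2 ^ (i - 1) * ((q - 1) div 2 ^ (i - 1) mod 2))"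
            by (simp add: \<xi>_def)
          also have "\<dots> = of_nat (q - 1)"
          proof -
            have "q - 1 < 2 ^ n" using q prime_gt_0_nat[of q] by linarith
            thus ?thesis unfolding sum_binary_digits by simp
          qed
          also have "of_nat (q - 1) + 1 = (of_int p :: rat)"
            using prime_gt_0_nat[OF q(1)] by (simp add: p_def of_nat_diff)
          finally show ?thesis using of_int_in_p_ideal_iff[OF p, of p] by simp
        next
          case boolean
          have "\<xi> i = 0 \<or> \<xi> i = 1" by (auto simp: \<xi>_def)
          hence "?e (Rs ! l) = 0"
            by (auto simp: boolean mpoly_eval_diff mpoly_eval_power \<rho>)
          thus ?thesis using p_ideal_0[OF p] by simp
        next
          case extension
          have Q: "Q i = var_poly (YVar i) - Rs ! l" using extension by simp
          \<comment> \<open>A definition that occurs as a line inherits p-integral coefficients from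
            that line, so the assignment satisfies it exactly.\<close>
          have "\<forall>c. Poly_Mapping.lookup (Q i) c \<in> p_integral p"
            unfolding Q lookup_minus using a_int[OF less.prems] p p_integral_0 p_integral_1
            by (intro allI p_integral_diff) (auto simp: var_poly_def lookup_single when_def)
          hence "?e (Rs ! l) = 0"
            using \<rho>(3)[OF extension(1)] by (simp add: extension mpoly_eval_diff)
          thus ?thesis using p_ideal_0[OF p] by simp
        next
          case comb
          show ?thesis
            unfolding e
          proof (rule D_comb[OF p ndvd less.prems comb(1,2)])
            show "\<forall>c. ?a l c = \<alpha> * ?a j c + \<beta> * ?a k c"
              by (simp add: comb lookup_add lookup_const_poly_mult)
            show "\<forall>i<l. (\<Sum>c | ?a i c \<noteq> 0. ?a i c * monom_eval \<rho> c) \<in> p_ideal p"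
              using IH unfolding e by blast
          qed
        next
          case mult
          thus ?thesis using p_ideal_mult[OF p IH[OF mult(1)] \<rho>(1)[of v]]
            by (simp add: mpoly_eval_mult mult.commute)
        next
          case sqrt
          have "?e (Rs ! l) * ?e (Rs ! l) = ?e (Rs ! k)"
            unfolding sqrt(2)[symmetric] by (simp add: mpoly_eval_mult power2_eq_square)
          moreover have "?e (Rs ! l) \<in> p_integral p"
            using a_int[OF less.prems] \<rho>(1) by (rule mpoly_eval_p_integral[OF p])
          ultimately show ?thesis using IH[OF sqrt(1)] p_ideal_prime_ideal[OF p] by metis
        qed
      qed
      note e_ideal = this
      obtain c where c: "c \<noteq> 0" "last Rs = const_poly c" and "Rs \<noteq> []"
        using pc unfolding pc_sqrt_refutation_def by blast
      define l where "l = ?L - 1"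
      have l: "l < ?L" "Rs ! l = const_poly c"
        using c(2) \<open>Rs \<noteq> []\<close> by (simp_all add: l_def last_conv_nth)
      have "c \<in> p_ideal p" using e_ideal[OF l(1)] by (simp add: l(2))
      have "?a l 0 = c" unfolding l(2) by (simp add: const_poly_def)
      hence "\<not> p dvd height c" using D_unit[OF p ndvd l(1), of 0] c(1) by simp
      thus False using not_dvd_height_unit[OF p] \<open>c \<in> p_ideal p\<close> by blast
    qed
    thus "q dvd nat \<bar>D\<bar>" by (simp add: p_def nat_abs_dvd_iff flip: int_dvd_int_iff)
  qed
qed

theorem theorem3p3:
  "\<exists>c::real. c > 0 \<and> (\<exists>N::nat. \<forall>n\<ge>N. \<forall>Rs :: (var, rat) mpoly list.
     ext_pc_sqrt_refutation n (BVP n) Rs \<longrightarrow> real_of_int (refutation_size Rs) \<ge> c * 2 ^ n)"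
proof -
  \<comment> \<open>The subtracted 1 is the charge for the prime 2. All error terms together are
    eventually below half of \<open>2 ^ n\<close>; dividing the remaining half by 9 yields
    1/18.\<close>
  have "eventually (\<lambda>n::nat. 2 ^ n / 2 \<le> 2 ^ n - real n - real (n + 1) * 2 powr (real (n + 1) / 2) - 1) at_top"
    by real_asymp
  then obtain N where N: "\<And>n. n \<ge> N \<Longrightarrow>
      2 ^ n / 2 \<le> 2 ^ n - real n - real (n + 1) * 2 powr (real (n + 1) / 2) - 1"
    by (auto simp: eventually_at_top_linorder)
  have "1 / 18 * 2 ^ n \<le> real_of_int (refutation_size Rs)"
    if n: "n \<ge> max N 1" and ref: "ext_pc_sqrt_refutation n (BVP n) Rs" for n and Rs :: "(var, rat) mpoly list"
  proof -
    have "n > 0" using n by simp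
    then obtain D :: nat where D: "D \<noteq> 0" "log 2 D \<le> 1 + 9 * real_of_int (refutation_size Rs)"
      "\<And>p. prime p \<Longrightarrow> p \<le> 2 ^ n \<Longrightarrow> p dvd D"
      using log_refutation_bound[OF ref] by blast
    have "2 ^ n / 2 \<le> 9 * real_of_int (refutation_size Rs)"
      using N[of n] n D(2) log_le_of_primes_dvd[OF D(1) \<open>n > 0\<close> D(3)] by simp
    thus ?thesis by simp
  qed
  hence "\<exists>N::nat. \<forall>n\<ge>N. \<forall>Rs :: (var, rat) mpoly list.
      ext_pc_sqrt_refutation n (BVP n) Rs \<longrightarrow> real_of_int (refutation_size Rs) \<ge> 1 / 18 * 2 ^ n"
    by blast
  moreover have "0 < (1 / 18 :: real)" by simp
  ultimately show ?thesis by blast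
qed

end
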